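(* Let $w=(a_1,\dots,a_n)$ be a word in even integers and let $\omega(w)=(-a_n,\dots,-a_1)$. Then $H(w)\cong H(\omega(w))$ as vector spaces.
   Context: Fix $q\in\mathbb C^\times$ not a root of unity. $U=U_q\widehat{\mathfrak{sl}}_2$ (level zero) is the unital associative $\mathbb C$-algebra with generators $e_0,e_1,f_0,f_1,K^{\pm1}$ and relations $KK^{-1}=K^{-1}K=1$, $Ke_1K^{-1}=q^2e_1$, $Kf_1K^{-1}=q^{-2}f_1$, $Ke_0K^{-1}=q^{-2}e_0$, $Kf_0K^{-1}=q^{2}f_0$, $[e_1,f_1]=-[e_0,f_0]=\frac{K-K^{-1}}{q-q^{-1}}$, $[e_1,f_0]=[e_0,f_1]=0$, and for $i\neq j$ in $\{0,1\}$: $e_i^3e_j-(q^2+1+q^{-2})e_i^2e_je_i+(q^2+1+q^{-2})e_ie_je_i^2-e_je_i^3=0$ and the same relation with $e$ replaced by $f$. Tensor products of $U$-modules are formed with the coproduct $\Delta(K^{\pm1})=K^{\pm1}\otimes K^{\pm1}$, $\Delta(e_0)=e_0\otimes K^{-1}+1\otimes e_0$, $\Delta(f_0)=f_0\otimes 1+K\otimes f_0$, $\Delta(e_1)=e_1\otimes K+1\otimes e_1$, $\Delta(f_1)=f_1\otimes 1+K^{-1}\otimes f_1$. The trivial module $\mathbb C$ has $e_i,f_i$ acting by $0$ and $K$ by $1$. For $a\in 2\mathbb Z$ the two-dimensional evaluation module, denoted simply $a$, has basis $v_+,v_-$ with $Kv_\pm=q^{\pm1}v_\pm$, $e_1v_-=v_+$,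 $e_1v_+=0$, $f_1v_+=v_-$, $f_1v_-=0$, and $e_0,f_0$ acting as $q^{a}f_1$, $q^{-a}e_1$ respectively. A word $w=(a_1,\dots,a_k)$ is a sequence of even integers, also regarded as the $U$-module $a_1\otimes\cdots\otimes a_k$. Put $H(w)=\mathrm{Hom}_U(\mathbb C,w)$. *)

theory Defs
  imports
    Complex_Main
    "HOL-Library.Poly_Mapping"
    "HOL-Library.Product_Plus"
    "HOL-Library.Function_Algebras"
    "HOL-Algebra.QuotRing"
begin

section \<open>Free vector spaces\<close>

text \<open>The type \<open>'i \<Rightarrow>\<^sub>0 complex\<close> is the complex vector space with basis \<open>'i\<close>;
  the basis vector at \<open>i\<close> is \<open>vec i\<close>.\<close>

definition smul :: "complex \<Rightarrow> ('i \<Rightarrow>\<^sub>0 complex) \<Rightarrow> ('i \<Rightarrow>\<^sub>0 complex)" where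
  "smul c x = Poly_Mapping.map ((*) c) x"

definition vec :: "'i \<Rightarrow> ('i \<Rightarrow>\<^sub>0 complex)" where
  "vec i = Poly_Mapping.single i 1"

definition lin_ext :: "('i \<Rightarrow> ('j \<Rightarrow>\<^sub>0 complex)) \<Rightarrow> ('i \<Rightarrow>\<^sub>0 complex) \<Rightarrow> ('j \<Rightarrow>\<^sub>0 complex)" where
  "lin_ext h x = (\<Sum>i\<in>Poly_Mapping.keys x. smul (Poly_Mapping.lookup x i) (h i))"

definition vtensor ::
  "('i \<Rightarrow>\<^sub>0 complex) \<Rightarrow> ('j \<Rightarrow>\<^sub>0 complex) \<Rightarrow> ('i \<times> 'j \<Rightarrow>\<^sub>0 complex)" where
  "vtensor x y = lin_ext (\<lambda>i. lin_ext (\<lambda>j. vec (i, j)) y) x"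

definition op_tensor ::
  "(('i \<Rightarrow>\<^sub>0 complex) \<Rightarrow> ('k \<Rightarrow>\<^sub>0 complex)) \<Rightarrow> (('j \<Rightarrow>\<^sub>0 complex) \<Rightarrow> ('l \<Rightarrow>\<^sub>0 complex))
    \<Rightarrow> ('i \<times> 'j \<Rightarrow>\<^sub>0 complex) \<Rightarrow> ('k \<times> 'l \<Rightarrow>\<^sub>0 complex)" where
  "op_tensor S T = lin_ext (\<lambda>(i, j). vtensor (S (vec i)) (T (vec j)))"


section \<open>The algebra\<close>

text \<open>Lists under concatenation are the free monoid, so \<open>ugen list \<Rightarrow>\<^sub>0 complex\<close> with the
  convolution product of \<^theory>\<open>HOL-Library.Poly_Mapping\<close> is the free unital associative algebra on
  the generators. Likewise \<open>ugen list \<times> ugen list \<Rightarrow>\<^sub>0 complex\<close>, the monoid algebra of the product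
  monoid, is the tensor square of that algebra, with \<open>vec (m, n)\<close> the pure tensor of the
  monomials \<open>m\<close> and \<open>n\<close>.\<close>

instantiation list :: (type) monoid_add
begin
definition zero_list_def: "(0 :: 'a list) = []"
definition plus_list_def: "(xs :: 'a list) + ys = xs @ ys"
instance by standard (simp_all add: zero_list_def plus_list_def)
end

datatype ugen = E0 | E1 | F0 | F1 | K | Kinv

type_synonym free_alg = "ugen list \<Rightarrow>\<^sub>0 complex"
type_synonym free_alg2 = "ugen list \<times> ugen list \<Rightarrow>\<^sub>0 complex"

definition gen :: "ugen \<Rightarrow> free_alg" where
  "gen g = vec [g]"

definition serre :: "complex \<Rightarrow> free_alg \<Rightarrow> free_alg \<Rightarrow> free_alg" where
  "serre q x y =
     x^3 * y - smul (q^2 + 1 + inverse (q^2)) (x^2 * y * x)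
     + smul (q^2 + 1 + inverse (q^2)) (x * y * x^2) - y * x^3"

definition U_relations :: "complex \<Rightarrow> free_alg set" where
  "U_relations q =
    {gen K * gen Kinv - 1, gen Kinv * gen K - 1,
     gen K * gen E1 * gen Kinv - smul (q^2) (gen E1),
     gen K * gen F1 * gen Kinv - smul (inverse (q^2)) (gen F1),
     gen K * gen E0 * gen Kinv - smul (inverse (q^2)) (gen E0),
     gen K * gen F0 * gen Kinv - smul (q^2) (gen F0),
     (gen E1 * gen F1 - gen F1 * gen E1) - smul (1 / (q - inverse q)) (gen K - gen Kinv),
     - (gen E0 * gen F0 - gen F0 * gen E0) - smul (1 / (q - inverse q)) (gen K - gen Kinv),
     gen E1 * gen F0 - gen F0 * gen E1,
     gen E0 * gen F1 - gen F1 * gen E0,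
     serre q (gen E0) (gen E1), serre q (gen E1) (gen E0),
     serre q (gen F0) (gen F1), serre q (gen F1) (gen F0)}"

definition free_ring :: "free_alg ring" where
  "free_ring = \<lparr>carrier = UNIV, monoid.mult = (*), one = 1, ring.zero = 0, add = (+)\<rparr>"

text \<open>Scalars lie in \<^const>\<open>free_ring\<close>, so its ring ideals are exactly its algebra ideals. The elements
  of \<open>U q\<close> are cosets.\<close>

definition U_ideal :: "complex \<Rightarrow> free_alg set" where
  "U_ideal q = Idl\<^bsub>free_ring\<^esub> (U_relations q)"

definition U :: "complex \<Rightarrow> free_alg set ring" where
  "U q = free_ring Quot (U_ideal q)"

definition U_class :: "complex \<Rightarrow> free_alg \<Rightarrow> free_alg set" where
  "U_class q x = U_ideal q +>\<^bsub>free_ring\<^esub> x"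

fun coproduct_gen :: "ugen \<Rightarrow> free_alg2" where
  "coproduct_gen K = vec ([K], [K])"
| "coproduct_gen Kinv = vec ([Kinv], [Kinv])"
| "coproduct_gen E0 = vec ([E0], [Kinv]) + vec ([], [E0])"
| "coproduct_gen F0 = vec ([F0], []) + vec ([K], [F0])"
| "coproduct_gen E1 = vec ([E1], [K]) + vec ([], [E1])"
| "coproduct_gen F1 = vec ([F1], []) + vec ([Kinv], [F1])"

definition coproduct :: "free_alg \<Rightarrow> free_alg2" where
  "coproduct = lin_ext (\<lambda>m. prod_list (map coproduct_gen m))"


section \<open>Modules\<close>

text \<open>A module is given by a basis (a set \<open>ubasis M\<close> of indices) and the action of the elements of
  \<open>U q\<close>; its underlying space is \<open>uspace M\<close>, and \<open>uact M\<close> is only meaningful on that space.\<close>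

record 'i umodule =
  ubasis :: "'i set"
  uact :: "free_alg set \<Rightarrow> ('i \<Rightarrow>\<^sub>0 complex) \<Rightarrow> ('i \<Rightarrow>\<^sub>0 complex)"

definition uspace :: "('i, 'm) umodule_scheme \<Rightarrow> ('i \<Rightarrow>\<^sub>0 complex) set" where
  "uspace M = {x. Poly_Mapping.keys x \<subseteq> ubasis M}"

definition free_eval ::
  "(ugen \<Rightarrow> ('i \<Rightarrow>\<^sub>0 complex) \<Rightarrow> ('i \<Rightarrow>\<^sub>0 complex)) \<Rightarrow> free_alg
    \<Rightarrow> ('i \<Rightarrow>\<^sub>0 complex) \<Rightarrow> ('i \<Rightarrow>\<^sub>0 complex)" where
  "free_eval \<rho> x v = lin_ext (\<lambda>m. foldr \<rho> m v) x"

text \<open>The module on which the generators act by given operators satisfying the relations: an element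
  of \<open>U q\<close> acts as any of its representatives does.\<close>

definition gen_module ::
  "'i set \<Rightarrow> (ugen \<Rightarrow> ('i \<Rightarrow>\<^sub>0 complex) \<Rightarrow> ('i \<Rightarrow>\<^sub>0 complex)) \<Rightarrow> 'i umodule" where
  "gen_module B \<rho> =
     \<lparr>ubasis = B, uact = (\<lambda>u v. the_elem ((\<lambda>x. free_eval \<rho> x v) ` u))\<rparr>"

fun trivial_op :: "ugen \<Rightarrow> (unit \<Rightarrow>\<^sub>0 complex) \<Rightarrow> (unit \<Rightarrow>\<^sub>0 complex)" where
  "trivial_op K = id"
| "trivial_op Kinv = id"
| "trivial_op E0 = (\<lambda>_. 0)"
| "trivial_op E1 = (\<lambda>_. 0)"
| "trivial_op F0 = (\<lambda>_. 0)"
| "trivial_op F1 = (\<lambda>_. 0)"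

definition trivial_module :: "unit umodule" where
  "trivial_module = gen_module UNIV trivial_op"

datatype sign = Plus | Minus

definition raise :: "sign \<Rightarrow> (sign \<Rightarrow>\<^sub>0 complex)" where
  "raise s = (case s of Plus \<Rightarrow> 0 | Minus \<Rightarrow> vec Plus)"

definition lower :: "sign \<Rightarrow> (sign \<Rightarrow>\<^sub>0 complex)" where
  "lower s = (case s of Plus \<Rightarrow> vec Minus | Minus \<Rightarrow> 0)"

fun weight :: "sign \<Rightarrow> int" where
  "weight Plus = 1"
| "weight Minus = -1"

fun evaluation_op :: "complex \<Rightarrow> int \<Rightarrow> ugen \<Rightarrow> (sign \<Rightarrow>\<^sub>0 complex) \<Rightarrow> (sign \<Rightarrow>\<^sub>0 complex)" where
  "evaluation_op q a K = lin_ext (\<lambda>s. smul (q powi weight s) (vec s))"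
| "evaluation_op q a Kinv = lin_ext (\<lambda>s. smul (q powi (- weight s)) (vec s))"
| "evaluation_op q a E1 = lin_ext raise"
| "evaluation_op q a F1 = lin_ext lower"
| "evaluation_op q a E0 = (\<lambda>v. smul (q powi a) (lin_ext lower v))"
| "evaluation_op q a F0 = (\<lambda>v. smul (q powi (- a)) (lin_ext raise v))"

definition evaluation_module :: "complex \<Rightarrow> int \<Rightarrow> sign umodule" where
  "evaluation_module q a = gen_module UNIV (evaluation_op q a)"

text \<open>The coproduct of the free algebra descends to \<open>U q\<close>, so the action on a tensor product may
  again be computed on any representative.\<close>

definition tensor_eval ::
  "complex \<Rightarrow> 'i umodule \<Rightarrow> 'j umodule \<Rightarrow> free_alg2
    \<Rightarrow> ('i \<times> 'j \<Rightarrow>\<^sub>0 complex) \<Rightarrow> ('i \<times> 'j \<Rightarrow>\<^sub>0 complex)" where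
  "tensor_eval q M N z v =
     lin_ext (\<lambda>(m, n). op_tensor (uact M (U_class q (vec m))) (uact N (U_class q (vec n))) v) z"

definition tensor_module :: "complex \<Rightarrow> 'i umodule \<Rightarrow> 'j umodule \<Rightarrow> ('i \<times> 'j) umodule" where
  "tensor_module q M N =
     \<lparr>ubasis = ubasis M \<times> ubasis N,
      uact = (\<lambda>u v. the_elem ((\<lambda>x. tensor_eval q M N (coproduct x) v) ` u))\<rparr>"

text \<open>Renaming the basis of \<open>M\<close> along a map injective on \<open>ubasis M\<close>.\<close>

definition relabel :: "('i \<Rightarrow> 'j) \<Rightarrow> 'i umodule \<Rightarrow> 'j umodule" where
  "relabel h M =
     \<lparr>ubasis = h ` ubasis M,
      uact = (\<lambda>u v. lin_ext (\<lambda>i. vec (h i))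
                (uact M u (lin_ext (\<lambda>j. vec (inv_into (ubasis M) h j)) v)))\<rparr>"

text \<open>The basis of \<open>a\<^sub>1 \<otimes> \<dots> \<otimes> a\<^sub>k\<close> is indexed by the sign lists of length \<open>k\<close>, so that all
  words give modules over one type; the empty word is the trivial module.\<close>

fun word_module :: "complex \<Rightarrow> int list \<Rightarrow> sign list umodule" where
  "word_module q [] = relabel (\<lambda>_. []) trivial_module"
| "word_module q [a] = relabel (\<lambda>s. [s]) (evaluation_module q a)"
| "word_module q (a # b # w) =
     relabel (\<lambda>(s, t). s # t) (tensor_module q (evaluation_module q a) (word_module q (b # w)))"


section \<open>Homomorphisms\<close>

text \<open>Homomorphisms are extended by \<open>0\<close> outside \<open>uspace M\<close>, so that equality of functions is
  equality of homomorphisms and the vector space operations on them are pointwise.\<close>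

definition Hom_U ::
  "complex \<Rightarrow> 'i umodule \<Rightarrow> 'j umodule \<Rightarrow> (('i \<Rightarrow>\<^sub>0 complex) \<Rightarrow> ('j \<Rightarrow>\<^sub>0 complex)) set" where
  "Hom_U q M N =
     {f. (\<forall>v\<in>uspace M. f v \<in> uspace N) \<and> (\<forall>v. v \<notin> uspace M \<longrightarrow> f v = 0)
       \<and> (\<forall>v\<in>uspace M. \<forall>v'\<in>uspace M. f (v + v') = f v + f v')
       \<and> (\<forall>c. \<forall>v\<in>uspace M. f (smul c v) = smul c (f v))
       \<and> (\<forall>u\<in>carrier (U q). \<forall>v\<in>uspace M. f (uact M u v) = uact N u (f v))}"

definition H :: "complex \<Rightarrow> int list \<Rightarrow> ((unit \<Rightarrow>\<^sub>0 complex) \<Rightarrow> (sign list \<Rightarrow>\<^sub>0 complex)) set" where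
  "H q w = Hom_U q trivial_module (word_module q w)"

definition hom_smul ::
  "complex \<Rightarrow> ('v \<Rightarrow> ('j \<Rightarrow>\<^sub>0 complex)) \<Rightarrow> ('v \<Rightarrow> ('j \<Rightarrow>\<^sub>0 complex))" where
  "hom_smul c f = (\<lambda>v. smul c (f v))"

definition hom_spaces_isomorphic ::
  "('v \<Rightarrow> ('i \<Rightarrow>\<^sub>0 complex)) set \<Rightarrow> ('w \<Rightarrow> ('j \<Rightarrow>\<^sub>0 complex)) set \<Rightarrow> bool" where
  "hom_spaces_isomorphic A B \<longleftrightarrow>
     (\<exists>\<phi>. bij_betw \<phi> A B
        \<and> (\<forall>f\<in>A. \<forall>g\<in>A. \<phi> (f + g) = \<phi> f + \<phi> g)
        \<and> (\<forall>c. \<forall>f\<in>A. \<phi> (hom_smul c f) = hom_smul c (\<phi> f)))"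

definition \<omega> :: "int list \<Rightarrow> int list" where
  "\<omega> w = rev (map uminus w)"

end

(* The algebra automorphism e1 <-> f0, f1 <-> e0, K -> K of U reverses the coproduct, and it pulls
   the evaluation module a back to a rescaled copy of -a. Reversing basis words, with a scalar q^-a
   for every Minus at a letter a, therefore intertwines the action on w with the twisted action on
   omega(w). The automorphism preserves the counit, so invariant vectors go to invariant vectors;
   the reversal map of omega(w) is the inverse. *)

theory Submission
  imports Defs
begin


section \<open>Linear maps on free vector spaces\<close>

text \<open>Module actions are given on cosets, through \<open>the_elem\<close>, so nothing can be
  computed before the generator operators are known to satisfy all relations, also on tensor
  products. Most of the work is this descent: the coproduct must respect the relations, and the
  Serre relations are the hard case. Once a module is replaced by six operators indexed by
  \<open>ugen\<close>, invariance is a condition on these operators, and the automorphism enters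
  only as a permutation of generators; it is never constructed on \<open>U q\<close>. The other
  obstacle is bracketing: word modules split off their first letter, but reversal turns the first
  letter into the last. Modelling the tensor product as concatenation in the monoid algebra of sign
  lists turns rebracketing into associativity of multiplication.\<close>

definition linear_op :: "(('i \<Rightarrow>\<^sub>0 complex) \<Rightarrow> ('j \<Rightarrow>\<^sub>0 complex)) \<Rightarrow> bool" where
  "linear_op f \<longleftrightarrow> (\<forall>x y. f (x + y) = f x + f y) \<and> (\<forall>c x. f (smul c x) = smul c (f x))"

lemma lookup_smul [simp]: "Poly_Mapping.lookup (smul c x) i = c * Poly_Mapping.lookup x i"
  by (simp add: smul_def Poly_Mapping.map.rep_eq when_def)

lemma lookup_vec: "Poly_Mapping.lookup (vec i) j = (if i = j then 1 else 0)"
  by (simp add: vec_def lookup_single when_def)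

lemma keys_vec [simp]: "Poly_Mapping.keys (vec i) = {i}"
  by (simp add: vec_def)

lemma smul_0 [simp]: "smul 0 x = 0" "smul c 0 = 0"
  and smul_1 [simp]: "smul 1 x = x"
  and smul_smul [simp]: "smul c (smul d x) = smul (c * d) x"
  and smul_add_right: "smul c (x + y) = smul c x + smul c y"
  and smul_add_left: "smul (c + d) x = smul c x + smul d x"
  and smul_diff_left: "smul (c - d) x = smul c x - smul d x"
  and smul_minus_right: "smul c (- x) = - smul c x"
  and smul_diff_right: "smul c (x - y) = smul c x - smul c y"
  by (rule poly_mapping_eqI; simp add: lookup_add lookup_minus algebra_simps)+

lemma smul_sum: "smul c (sum f A) = (\<Sum>i\<in>A. smul c (f i))"
  by (rule poly_mapping_eqI) (simp add: lookup_sum sum_distrib_left)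

lemma linear_opI:
  assumes "\<And>x y. f (x + y) = f x + f y" and "\<And>c x. f (smul c x) = smul c (f x)"
  shows "linear_op f"
  using assms by (simp add: linear_op_def)

lemma linear_opD:
  assumes "linear_op f"
  shows "f (x + y) = f x + f y" and "f (smul c x) = smul c (f x)" and "f 0 = 0"
    and "f (- x) = - f x" and "f (x - y) = f x - f y"
proof -
  show add: "f (x + y) = f x + f y" and smul: "f (smul c x) = smul c (f x)" for x y c
    using assms by (simp_all add: linear_op_def)
  show "f 0 = 0"
    using smul[of 0 0] by simp
  have neg: "smul (- 1) z = - z" for z :: "'c \<Rightarrow>\<^sub>0 complex"
    by (rule poly_mapping_eqI) simp
  show "f (- x) = - f x" for x
    using smul[of "- 1" x] by (simp add: neg)
  then show "f (x - y) = f x - f y"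
    using add[of x "- y"] by simp
qed

lemma linear_op_sum:
  assumes "linear_op f"
  shows "f (sum g A) = (\<Sum>i\<in>A. f (g i))"
  by (induction A rule: infinite_finite_induct) (simp_all add: linear_opD[OF assms])

lemma linear_op_id: "linear_op id" "linear_op (\<lambda>x. x)"
  and linear_op_zero: "linear_op (\<lambda>_. 0)"
  and linear_op_smul: "linear_op (smul c)"
  by (auto intro!: linear_opI simp: smul_add_right mult.commute)

lemma linear_op_compose: "linear_op f \<Longrightarrow> linear_op g \<Longrightarrow> linear_op (\<lambda>x. f (g x))"
  by (simp add: linear_op_def)

lemma linear_op_plus: "linear_op f \<Longrightarrow> linear_op g \<Longrightarrow> linear_op (\<lambda>x. f x + g x)"
  by (simp add: linear_op_def smul_add_right)

lemma poly_mapping_expand: "x = (\<Sum>i\<in>Poly_Mapping.keys x. smul (Poly_Mapping.lookup x i) (vec i))"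
proof (rule poly_mapping_eqI)
  fix k
  have "(\<Sum>i\<in>Poly_Mapping.keys x. Poly_Mapping.lookup x i * (if i = k then 1 else 0))
      = (\<Sum>i\<in>Poly_Mapping.keys x. if i = k then Poly_Mapping.lookup x i else 0)"
    by (rule sum.cong) auto
  then show "Poly_Mapping.lookup x k
      = Poly_Mapping.lookup (\<Sum>i\<in>Poly_Mapping.keys x. smul (Poly_Mapping.lookup x i) (vec i)) k"
    by (simp add: lookup_sum lookup_vec in_keys_iff)
qed

lemma linear_op_eq_on:
  assumes "linear_op f" and "linear_op g" and "\<And>i. i \<in> B \<Longrightarrow> f (vec i) = g (vec i)"
    and "Poly_Mapping.keys x \<subseteq> B"
  shows "f x = g x"
proof -
  have "f x = (\<Sum>i\<in>Poly_Mapping.keys x. smul (Poly_Mapping.lookup x i) (f (vec i)))"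
    by (subst poly_mapping_expand) (simp only: linear_op_sum[OF assms(1)] linear_opD[OF assms(1)])
  also have "\<dots> = (\<Sum>i\<in>Poly_Mapping.keys x. smul (Poly_Mapping.lookup x i) (g (vec i)))"
    using assms(3,4) by (intro sum.cong) auto
  also have "\<dots> = g x"
    by (subst (3) poly_mapping_expand)
      (simp only: linear_op_sum[OF assms(2)] linear_opD[OF assms(2)])
  finally show ?thesis .
qed

lemma linear_op_eqI:
  assumes "linear_op f" and "linear_op g" and "\<And>i. f (vec i) = g (vec i)"
  shows "f x = g x"
  using linear_op_eq_on[OF assms(1,2), of UNIV x] assms(3) by simp

lemma lin_ext_superset:
  assumes "finite A" and "Poly_Mapping.keys x \<subseteq> A"
  shows "lin_ext h x = (\<Sum>i\<in>A. smul (Poly_Mapping.lookup x i) (h i))"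
  unfolding lin_ext_def using assms
  by (intro sum.mono_neutral_left) (auto simp: in_keys_iff)

lemma linear_op_lin_ext [simp]: "linear_op (lin_ext h)"
proof (rule linear_opI)
  fix x y :: "'a \<Rightarrow>\<^sub>0 complex" and c
  let ?A = "Poly_Mapping.keys x \<union> Poly_Mapping.keys y"
  show "lin_ext h (x + y) = lin_ext h x + lin_ext h y"
    using lin_ext_superset[of ?A x h] lin_ext_superset[of ?A y h]
      lin_ext_superset[of ?A "x + y" h] keys_add[of x y]
    by (simp add: lookup_add smul_add_left sum.distrib)
  have "Poly_Mapping.keys (smul c x) \<subseteq> Poly_Mapping.keys x"
    by (auto simp: in_keys_iff)
  then show "lin_ext h (smul c x) = smul c (lin_ext h x)"
    using lin_ext_superset[of "Poly_Mapping.keys x" "smul c x" h]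
    by (simp add: lin_ext_def smul_sum)
qed

lemma lin_ext_vec [simp]: "lin_ext h (vec i) = h i"
  by (simp add: lin_ext_def lookup_vec)

lemmas lin_ext_simps = linear_opD[OF linear_op_lin_ext]

lemma lin_ext_linear_op: "linear_op f \<Longrightarrow> lin_ext (\<lambda>i. f (vec i)) = f"
  by (rule ext, rule linear_op_eqI) auto

lemma lin_ext_cong_keys:
  "(\<And>i. i \<in> Poly_Mapping.keys x \<Longrightarrow> h i = h' i) \<Longrightarrow> lin_ext h x = lin_ext h' x"
  by (simp add: lin_ext_def)

text \<open>Linearity in a parameter of the basis images, with the combination \<open>y\<close>
  fixed; this makes the action of a fixed algebra element linear in the vector.\<close>

lemma linear_op_lin_ext_pointwise:
  assumes "\<And>i. linear_op (\<lambda>x. h x i)"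
  shows "linear_op (\<lambda>x. lin_ext (h x) y)"
  by (rule linear_opI) (simp_all add: lin_ext_def linear_opD[OF assms] smul_add_right sum.distrib
      smul_sum mult.commute)


section \<open>Supported subspaces\<close>

text \<open>Sign lists of all lengths share one type, so the space of a word is the span of part of
  the basis, and operators are controlled only there.\<close>

definition supp_space :: "'i set \<Rightarrow> ('i \<Rightarrow>\<^sub>0 complex) set" where
  "supp_space B = {x. Poly_Mapping.keys x \<subseteq> B}"

lemma uspace_eq: "uspace M = supp_space (ubasis M)"
  by (simp add: uspace_def supp_space_def)

lemma supp_space_UNIV [simp]: "supp_space UNIV = UNIV"
  by (simp add: supp_space_def)

lemma supp_space_closed [simp]:
  shows "0 \<in> supp_space B"
    and "x \<in> supp_space B \<Longrightarrow> y \<in> supp_space B \<Longrightarrow> x + y \<in> supp_space B"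
    and "x \<in> supp_space B \<Longrightarrow> y \<in> supp_space B \<Longrightarrow> x - y \<in> supp_space B"
    and "x \<in> supp_space B \<Longrightarrow> smul c x \<in> supp_space B"
    and "vec i \<in> supp_space B \<longleftrightarrow> i \<in> B"
  by (auto simp: supp_space_def in_keys_iff lookup_add lookup_minus)
    (metis add.left_neutral in_keys_iff subsetD, metis diff_0_right in_keys_iff subsetD)

lemma supp_space_sum: "(\<And>i. i \<in> A \<Longrightarrow> f i \<in> supp_space B) \<Longrightarrow> sum f A \<in> supp_space B"
  by (induction A rule: infinite_finite_induct) auto

lemma lin_ext_supp_space:
  assumes "\<And>i. i \<in> A \<Longrightarrow> h i \<in> supp_space B" and "x \<in> supp_space A"
  shows "lin_ext h x \<in> supp_space B"
  using assms unfolding lin_ext_def by (intro supp_space_sum) (auto simp: supp_space_def[of A])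

lemma linear_op_supp_space:
  assumes "linear_op f" and "\<And>i. i \<in> A \<Longrightarrow> f (vec i) \<in> supp_space B" and "x \<in> supp_space A"
  shows "f x \<in> supp_space B"
  using lin_ext_supp_space[of A "\<lambda>i. f (vec i)" B x] assms by (simp add: lin_ext_linear_op)


section \<open>Bilinear operations\<close>

text \<open>Pairings stay abstract because the coproduct formulas are used for
  \<open>vtensor\<close>, for its flip, and for concatenation with a letter in front or
  behind.\<close>

definition bilinear_op ::
  "(('i \<Rightarrow>\<^sub>0 complex) \<Rightarrow> ('j \<Rightarrow>\<^sub>0 complex) \<Rightarrow> ('k \<Rightarrow>\<^sub>0 complex)) \<Rightarrow> bool" where
  "bilinear_op m \<longleftrightarrow> (\<forall>y. linear_op (\<lambda>x. m x y)) \<and> (\<forall>x. linear_op (m x))"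

lemma bilinear_opD:
  assumes "bilinear_op m"
  shows "linear_op (\<lambda>x. m x y)" and "linear_op (m x)"
  using assms by (auto simp: bilinear_op_def)

lemmas bilinear_op_simps = linear_opD[OF bilinear_opD(1)] linear_opD[OF bilinear_opD(2)]

lemma bilinear_op_eq_on:
  assumes "bilinear_op m" and "bilinear_op m'"
    and "\<And>i j. i \<in> A \<Longrightarrow> j \<in> B \<Longrightarrow> m (vec i) (vec j) = m' (vec i) (vec j)"
    and "x \<in> supp_space A" and "y \<in> supp_space B"
  shows "m x y = m' x y"
proof (rule linear_op_eq_on[where B = A])
  show "m (vec i) y = m' (vec i) y" if "i \<in> A" for i
    by (rule linear_op_eq_on[where B = B])
      (use assms that in \<open>auto simp: bilinear_opD supp_space_def\<close>)
qed (use assms in \<open>auto simp: bilinear_opD supp_space_def\<close>)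

lemma bilinear_op_compose:
  assumes "bilinear_op m" and "linear_op f" and "linear_op g"
  shows "bilinear_op (\<lambda>x y. m (f x) (g y))"
  unfolding bilinear_op_def
  by (intro conjI allI linear_op_compose[OF bilinear_opD(1)[OF assms(1)] assms(2)]
      linear_op_compose[OF bilinear_opD(2)[OF assms(1)] assms(3)])

lemma bilinear_op_plus:
  "bilinear_op m \<Longrightarrow> bilinear_op m' \<Longrightarrow> bilinear_op (\<lambda>x y. m x y + m' x y)"
  by (simp add: bilinear_op_def linear_op_plus)

lemma linear_op_bilinear_op:
  "linear_op f \<Longrightarrow> bilinear_op m \<Longrightarrow> bilinear_op (\<lambda>x y. f (m x y))"
  by (simp add: bilinear_op_def linear_op_def)

lemma bilinear_op_flip: "bilinear_op m \<Longrightarrow> bilinear_op (\<lambda>x y. m y x)"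
  by (simp add: bilinear_op_def)

text \<open>Two nested linear extensions treat the arguments asymmetrically; the product formula for
  coordinates makes linearity in both visible.\<close>

lemma lookup_vtensor:
  "Poly_Mapping.lookup (vtensor x y) (i, j) = Poly_Mapping.lookup x i * Poly_Mapping.lookup y j"
proof -
  have inner: "Poly_Mapping.lookup (lin_ext (\<lambda>j. vec (i', j)) y) (i, j)
      = (if i' = i then Poly_Mapping.lookup y j else 0)" for i'
  proof -
    have "Poly_Mapping.lookup (lin_ext (\<lambda>j. vec (i', j)) y) (i, j)
        = (\<Sum>j'\<in>Poly_Mapping.keys y. if j' = j then
            (if i' = i then Poly_Mapping.lookup y j' else 0) else 0)"
      unfolding lin_ext_def lookup_sum by (rule sum.cong) (auto simp: lookup_vec)
    then show ?thesis by (simp add: in_keys_iff)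
  qed
  have "Poly_Mapping.lookup (vtensor x y) (i, j)
      = (\<Sum>i'\<in>Poly_Mapping.keys x. if i' = i then
          Poly_Mapping.lookup x i' * Poly_Mapping.lookup y j else 0)"
    unfolding vtensor_def lin_ext_def[of _ x] lookup_sum
    by (rule sum.cong) (auto simp: inner)
  then show ?thesis by (simp add: in_keys_iff)
qed

lemma bilinear_op_vtensor: "bilinear_op vtensor"
proof -
  have ext: "z = z'" if "\<And>i j. Poly_Mapping.lookup z (i, j) = Poly_Mapping.lookup z' (i, j)"
    for z z' :: "('i \<times> 'j) \<Rightarrow>\<^sub>0 complex"
    using that by (intro poly_mapping_eqI) auto
  show ?thesis
    unfolding bilinear_op_def
    by (intro conjI allI linear_opI ext) (simp_all add: lookup_vtensor lookup_add algebra_simps)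
qed

lemma vtensor_vec [simp]: "vtensor (vec i) (vec j) = vec (i, j)"
  by (simp add: vtensor_def)

lemma linear_op_op_tensor [simp]: "linear_op (op_tensor S T)"
  by (simp add: op_tensor_def)

lemma op_tensor_vtensor:
  assumes "linear_op S" and "linear_op T"
  shows "op_tensor S T (vtensor x y) = vtensor (S x) (T y)"
proof (rule bilinear_op_eq_on[where A = UNIV and B = UNIV
      and m = "\<lambda>x y. op_tensor S T (vtensor x y)" and m' = "\<lambda>x y. vtensor (S x) (T y)"])
  show "bilinear_op (\<lambda>x y. op_tensor S T (vtensor x y))"
    by (rule linear_op_bilinear_op[OF _ bilinear_op_vtensor]) simp
  show "bilinear_op (\<lambda>x y. vtensor (S x) (T y))"
    by (rule bilinear_op_compose[OF bilinear_op_vtensor assms])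
qed (simp_all add: op_tensor_def)

lemma vtensor_supp_space:
  "x \<in> supp_space A \<Longrightarrow> y \<in> supp_space B \<Longrightarrow> vtensor x y \<in> supp_space (A \<times> B)"
  by (auto simp: supp_space_def in_keys_iff lookup_vtensor subset_iff)

text \<open>Scalars are the multiples of the unit monomial, hence central although the monoid
  algebra is noncommutative. Linearity of multiplication in the right factor rests on this.\<close>

lemma single_zero_commute:
  fixes y :: "'i::monoid_add \<Rightarrow>\<^sub>0 complex"
  shows "y * Poly_Mapping.single 0 c = Poly_Mapping.single 0 c * y"
proof (induction y rule: update_induct)
  case (update f a b)
  have *: "Poly_Mapping.update a b f = f + Poly_Mapping.single a b"
    using update by (intro poly_mapping_eqI)
      (auto simp: lookup_update lookup_add lookup_single when_def in_keys_iff)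
  show ?case
    unfolding * by (simp add: algebra_simps update mult_single)
qed simp

lemma bilinear_op_times: "bilinear_op ((*) :: ('i::monoid_add \<Rightarrow>\<^sub>0 complex) \<Rightarrow> _)"
proof -
  have smul: "smul c x = Poly_Mapping.single 0 c * x" for c and x :: "'i \<Rightarrow>\<^sub>0 complex"
    by (simp add: smul_def mult_map_scale_conv_mult)
  show ?thesis
    unfolding bilinear_op_def
    by (intro conjI allI linear_opI)
      (simp_all add: algebra_simps smul, metis mult.assoc single_zero_commute)
qed

lemma times_vec: "vec m * vec n = vec (m + n)"
  by (simp add: vec_def mult_single)

lemma one_eq_vec: "1 = vec 0"
  by (simp add: vec_def)


section \<open>Actions of the free algebra\<close>

lemma linear_op_foldr: "(\<And>g. linear_op (\<rho> g)) \<Longrightarrow> linear_op (foldr \<rho> m)"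
  by (induction m) (auto simp: linear_op_id comp_def intro: linear_op_compose)

lemma linear_op_free_eval_left: "linear_op (\<lambda>x. free_eval \<rho> x v)"
  by (simp add: free_eval_def)

lemma linear_op_free_eval: "(\<And>g. linear_op (\<rho> g)) \<Longrightarrow> linear_op (free_eval \<rho> x)"
  unfolding free_eval_def
  by (rule linear_op_lin_ext_pointwise) (rule linear_op_foldr)

lemma free_eval_vec [simp]: "free_eval \<rho> (vec m) v = foldr \<rho> m v"
  by (simp add: free_eval_def)

lemma free_eval_gen [simp]: "free_eval \<rho> (gen g) v = \<rho> g v"
  by (simp add: gen_def)

lemma free_eval_1 [simp]: "free_eval \<rho> 1 v = v"
  by (simp add: one_eq_vec zero_list_def)

text \<open>\<open>foldr\<close> over an append composes, so products of monomials act by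
  composition; bilinearity extends this to all elements.\<close>

lemma free_eval_mult:
  assumes "\<And>g. linear_op (\<rho> g)"
  shows "free_eval \<rho> (x * y) v = free_eval \<rho> x (free_eval \<rho> y v)"
proof (rule bilinear_op_eq_on[where A = UNIV and B = UNIV and m = "\<lambda>x y. free_eval \<rho> (x * y) v"
      and m' = "\<lambda>x y. free_eval \<rho> x (free_eval \<rho> y v)"])
  show "bilinear_op (\<lambda>x y. free_eval \<rho> (x * y) v)"
    by (rule linear_op_bilinear_op[OF linear_op_free_eval_left bilinear_op_times])
  show "bilinear_op (\<lambda>x y. free_eval \<rho> x (free_eval \<rho> y v))"
    unfolding bilinear_op_def
    by (intro conjI allI linear_op_free_eval_left
        linear_op_compose[OF linear_op_free_eval[OF assms] linear_op_free_eval_left])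
qed (simp_all add: times_vec plus_list_def)

lemmas free_eval_simps = linear_opD[OF linear_op_free_eval_left]

lemma free_eval_supp_space:
  assumes "\<And>g v. v \<in> supp_space B \<Longrightarrow> \<rho> g v \<in> supp_space B" and "v \<in> supp_space B"
  shows "free_eval \<rho> x v \<in> supp_space B"
proof -
  have "foldr \<rho> m v \<in> supp_space B" for m
    using assms by (induction m) auto
  then show ?thesis
    unfolding free_eval_def by (intro lin_ext_supp_space[where A = UNIV]) auto
qed

lemma free_eval_intertwine:
  assumes "linear_op P" and "\<And>g v. v \<in> supp_space B \<Longrightarrow> \<rho> g v \<in> supp_space B"
    and "\<And>g v. v \<in> supp_space B \<Longrightarrow> P (\<rho> g v) = \<sigma> g (P v)" and "v \<in> supp_space B"
  shows "P (free_eval \<rho> x v) = free_eval \<sigma> x (P v)"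
proof (rule linear_op_eqI[where f = "\<lambda>x. P (free_eval \<rho> x v)"])
  fix m
  have "foldr \<rho> m v \<in> supp_space B \<and> P (foldr \<rho> m v) = foldr \<sigma> m (P v)"
    using assms(2-4) by (induction m) auto
  then show "P (free_eval \<rho> (vec m) v) = free_eval \<sigma> (vec m) (P v)" by simp
qed (auto intro: linear_op_compose[OF assms(1)] linear_op_free_eval_left)

definition serre_act where
  "serre_act q f g v =
     f (f (f (g v))) - smul (q^2 + 1 + inverse (q^2)) (f (f (g (f v))))
     + smul (q^2 + 1 + inverse (q^2)) (f (g (f (f v)))) - g (f (f (f v)))"

lemma free_eval_serre:
  assumes "\<And>g. linear_op (\<rho> g)"
  shows "free_eval \<rho> (serre q (gen g) (gen h)) v = serre_act q (\<rho> g) (\<rho> h) v"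
  by (simp add: serre_def serre_act_def free_eval_simps free_eval_mult[OF assms]
      power2_eq_square power3_eq_cube)

text \<open>Moves the relations from the free algebra to operators. The two nonzero commutators are
  oriented so that both serve as rewrite rules with the same correction term.\<close>

lemma free_eval_relations:
  assumes "\<And>g. linear_op (\<rho> g)"
  shows "(\<forall>r\<in>U_relations q. free_eval \<rho> r v = 0) \<longleftrightarrow>
     \<rho> K (\<rho> Kinv v) = v \<and> \<rho> Kinv (\<rho> K v) = v
     \<and> \<rho> K (\<rho> E1 (\<rho> Kinv v)) = smul (q^2) (\<rho> E1 v)
     \<and> \<rho> K (\<rho> F1 (\<rho> Kinv v)) = smul (inverse (q^2)) (\<rho> F1 v)
     \<and> \<rho> K (\<rho> E0 (\<rho> Kinv v)) = smul (inverse (q^2)) (\<rho> E0 v)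
     \<and> \<rho> K (\<rho> F0 (\<rho> Kinv v)) = smul (q^2) (\<rho> F0 v)
     \<and> \<rho> E1 (\<rho> F1 v) = \<rho> F1 (\<rho> E1 v) + smul (1 / (q - inverse q)) (\<rho> K v - \<rho> Kinv v)
     \<and> \<rho> F0 (\<rho> E0 v) = \<rho> E0 (\<rho> F0 v) + smul (1 / (q - inverse q)) (\<rho> K v - \<rho> Kinv v)
     \<and> \<rho> E1 (\<rho> F0 v) = \<rho> F0 (\<rho> E1 v) \<and> \<rho> E0 (\<rho> F1 v) = \<rho> F1 (\<rho> E0 v)
     \<and> serre_act q (\<rho> E0) (\<rho> E1) v = 0 \<and> serre_act q (\<rho> E1) (\<rho> E0) v = 0
     \<and> serre_act q (\<rho> F0) (\<rho> F1) v = 0 \<and> serre_act q (\<rho> F1) (\<rho> F0) v = 0"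
  unfolding U_relations_def ball_simps
  by (simp only: free_eval_serre[OF assms])
    (simp add: free_eval_simps free_eval_mult[OF assms] algebra_simps)


section \<open>Actions factoring through the quotient algebra\<close>

text \<open>The relations are demanded on a subspace only, since total operators may violate them
  elsewhere: \<open>word_op\<close> of a nonempty word kills the empty list, so \<open>K\<close> is
  not invertible there.\<close>

definition U_action ::
  "complex \<Rightarrow> 'i set \<Rightarrow> (ugen \<Rightarrow> ('i \<Rightarrow>\<^sub>0 complex) \<Rightarrow> ('i \<Rightarrow>\<^sub>0 complex)) \<Rightarrow> bool" where
  "U_action q B \<rho> \<longleftrightarrow> (\<forall>g. linear_op (\<rho> g)) \<and> (\<forall>g. \<forall>v\<in>supp_space B. \<rho> g v \<in> supp_space B)
     \<and> (\<forall>v\<in>supp_space B. \<forall>r\<in>U_relations q. free_eval \<rho> r v = 0)"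

lemma U_actionD:
  assumes "U_action q B \<rho>"
  shows "linear_op (\<rho> g)" and "v \<in> supp_space B \<Longrightarrow> \<rho> g v \<in> supp_space B"
    and "v \<in> supp_space B \<Longrightarrow> r \<in> U_relations q \<Longrightarrow> free_eval \<rho> r v = 0"
  using assms by (auto simp: U_action_def)

section \<open>The ideal of relations and its cosets\<close>

lemma ring_free_ring: "ring free_ring"
proof -
  have "\<exists>y. y + x = 0" for x :: free_alg
    by (rule exI[of _ "- x"]) simp
  then show ?thesis
    unfolding free_ring_def by unfold_locales (auto simp: algebra_simps Units_def)
qed

lemma ideal_U_ideal: "ideal (U_ideal q) free_ring"
  unfolding U_ideal_def
  by (rule ring.genideal_ideal[OF ring_free_ring]) (simp add: free_ring_def)

lemma U_class_eq: "U_class q x = {h + x | h. h \<in> U_ideal q}"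
  by (auto simp: U_class_def a_r_coset_def r_coset_def free_ring_def)

lemma zero_mem_U_ideal: "0 \<in> U_ideal q"
  using additive_subgroup.zero_closed[OF ideal.axioms(1)[OF ideal_U_ideal]]
  by (simp add: free_ring_def)

lemma carrier_U: "carrier (U q) = range (U_class q)"
  by (auto simp: U_def FactRing_def A_RCOSETS_def RCOSETS_def U_class_def a_r_coset_def
      free_ring_def)

text \<open>The annihilator of an invariant subspace is a two-sided ideal: linearity gives closure
  under left multiplication, invariance under right multiplication. It contains the relations, hence
  everything they generate.\<close>

lemma U_action_ideal:
  assumes "U_action q B \<rho>" and "h \<in> U_ideal q" and "v \<in> supp_space B"
  shows "free_eval \<rho> h v = 0"
proof -
  note lin = U_actionD(1)[OF assms(1)]
  let ?I = "{x. \<forall>v\<in>supp_space B. free_eval \<rho> x v = 0}"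
  have "ideal ?I free_ring"
  proof (rule idealI)
    show "subgroup ?I (add_monoid free_ring)"
    proof (rule group.subgroupI)
      show "group (add_monoid free_ring)"
        using abelian_group.a_group[OF ring.is_abelian_group[OF ring_free_ring]] .
      fix a assume a: "a \<in> ?I"
      have "inv\<^bsub>add_monoid free_ring\<^esub> a = - a"
        by (rule group.inv_equality[OF \<open>group (add_monoid free_ring)\<close>]) (auto simp: free_ring_def)
      then show "inv\<^bsub>add_monoid free_ring\<^esub> a \<in> ?I"
        using a by (simp add: free_eval_simps)
    qed (auto simp: free_ring_def free_eval_simps intro!: exI[of _ 0])
  qed (rule ring_free_ring, auto simp: free_ring_def free_eval_mult[OF lin] linear_opD[OF
      linear_op_free_eval[OF lin]]
      intro!: free_eval_supp_space U_actionD(2)[OF assms(1)])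
  moreover have "U_relations q \<subseteq> ?I"
    using U_actionD(3)[OF assms(1)] by auto
  ultimately have "U_ideal q \<subseteq> ?I"
    unfolding U_ideal_def by (rule ring.genideal_minimal[OF ring_free_ring])
  then show ?thesis using assms by auto
qed

text \<open>All representatives act alike, as they differ by elements of the ideal, and the coset is
  nonempty, as the ideal contains \<open>0\<close>; so the image is a singleton.\<close>

lemma the_elem_U_class:
  assumes "U_action q B \<rho>" and "v \<in> supp_space B"
  shows "the_elem ((\<lambda>x. free_eval \<rho> x v) ` U_class q x) = free_eval \<rho> x v"
proof -
  have "(\<lambda>x. free_eval \<rho> x v) ` U_class q x = {free_eval \<rho> x v}"
    using zero_mem_U_ideal U_action_ideal[OF assms(1) _ assms(2)]
    by (force simp: U_class_eq free_eval_simps image_iff)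
  then show ?thesis by simp
qed

text \<open>The bridge from coset actions to computable operators. Agreement is claimed only on the
  underlying space, where \<open>uact\<close> is meaningful.\<close>

definition realizes ::
  "complex \<Rightarrow> 'i umodule \<Rightarrow> (ugen \<Rightarrow> ('i \<Rightarrow>\<^sub>0 complex) \<Rightarrow> ('i \<Rightarrow>\<^sub>0 complex)) \<Rightarrow> bool" where
  "realizes q M \<rho> \<longleftrightarrow> U_action q (ubasis M) \<rho>
     \<and> (\<forall>x. \<forall>v\<in>supp_space (ubasis M). uact M (U_class q x) v = free_eval \<rho> x v)"

lemma realizes_gen_module: "U_action q B \<rho> \<Longrightarrow> realizes q (gen_module B \<rho>) \<rho>"
  by (simp add: realizes_def gen_module_def the_elem_U_class)

text \<open>Relabelling conjugates the action by a bijection of bases. The operators \<tau> are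
  prescribed in advance and compared with the conjugated ones on basis vectors, so they may come
  from an independent recursion.\<close>

lemma realizes_relabel:
  assumes M: "realizes q M \<rho>" and inj: "inj_on h (ubasis M)" and lin: "\<And>g. linear_op (\<tau> g)"
    and \<tau>: "\<And>g i. i \<in> ubasis M \<Longrightarrow> \<tau> g (vec (h i)) = lin_ext (\<lambda>i. vec (h i)) (\<rho> g (vec i))"
  shows "realizes q (relabel h M) \<tau>"
proof -
  let ?B = "ubasis M" and ?push = "lin_ext (\<lambda>i. vec (h i))"
    and ?pull = "lin_ext (\<lambda>j. vec (inv_into (ubasis M) h j))"
  have \<rho>: "U_action q ?B \<rho>" using M by (simp add: realizes_def)
  note \<rho>D = U_actionD[OF \<rho>]
  have push: "?push v \<in> supp_space (h ` ?B)" if "v \<in> supp_space ?B" for v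
    using that by (rule lin_ext_supp_space[rotated]) auto
  have pull: "?pull v \<in> supp_space ?B" if "v \<in> supp_space (h ` ?B)" for v
    using that by (rule lin_ext_supp_space[rotated]) (auto simp: inv_into_into)
  have push_pull: "?push (?pull v) = v" if "v \<in> supp_space (h ` ?B)" for v
    by (rule linear_op_eq_on[where B = "h ` ?B" and f = "\<lambda>v. ?push (?pull v)" and g = "\<lambda>v. v"])
      (use that inj in \<open>auto simp: linear_op_id supp_space_def linear_op_compose[OF
          linear_op_lin_ext linear_op_lin_ext]\<close>)
  have inter: "?push (\<rho> g v) = \<tau> g (?push v)" if "v \<in> supp_space ?B" for g v
    by (rule linear_op_eq_on[where B = ?B and f = "\<lambda>v. ?push (\<rho> g v)"])
      (use that in \<open>auto simp: supp_space_def \<tau> linear_op_compose[OF linear_op_lin_ext \<rho>D(1)]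
        linear_op_compose[OF lin linear_op_lin_ext]\<close>)
  have eval: "?push (free_eval \<rho> x v) = free_eval \<tau> x (?push v)" if "v \<in> supp_space ?B" for x v
    by (rule free_eval_intertwine[where B = ?B]) (use that in \<open>auto simp: \<rho>D inter\<close>)
  have "U_action q (h ` ?B) \<tau>"
    unfolding U_action_def
  proof (intro conjI allI ballI lin)
    fix g v assume v: "v \<in> supp_space (h ` ?B)"
    show "\<tau> g v \<in> supp_space (h ` ?B)"
      using inter[OF pull[OF v], of g] push[OF \<rho>D(2)[OF pull[OF v]], of g] push_pull[OF v] by simp
    fix r assume "r \<in> U_relations q"
    then show "free_eval \<tau> r v = 0"
      using eval[OF pull[OF v], of r] \<rho>D(3)[OF pull[OF v]] push_pull[OF v] by (simp add:
          lin_ext_simps)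
  qed
  then show ?thesis
    using M eval pull push_pull by (simp add: realizes_def relabel_def)
qed


section \<open>Tensor products\<close>

text \<open>The coproduct on generators in Sweedler form, with an arbitrary pairing in place of the
  tensor product.\<close>

fun comult_op ::
  "(('i \<Rightarrow>\<^sub>0 complex) \<Rightarrow> ('j \<Rightarrow>\<^sub>0 complex) \<Rightarrow> ('k \<Rightarrow>\<^sub>0 complex))
    \<Rightarrow> (ugen \<Rightarrow> ('i \<Rightarrow>\<^sub>0 complex) \<Rightarrow> ('i \<Rightarrow>\<^sub>0 complex)) \<Rightarrow> (ugen \<Rightarrow> ('j \<Rightarrow>\<^sub>0 complex) \<Rightarrow> ('j \<Rightarrow>\<^sub>0 complex))
    \<Rightarrow> ugen \<Rightarrow> ('i \<Rightarrow>\<^sub>0 complex) \<Rightarrow> ('j \<Rightarrow>\<^sub>0 complex) \<Rightarrow> ('k \<Rightarrow>\<^sub>0 complex)" where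
  "comult_op m \<rho> \<sigma> K x y = m (\<rho> K x) (\<sigma> K y)"
| "comult_op m \<rho> \<sigma> Kinv x y = m (\<rho> Kinv x) (\<sigma> Kinv y)"
| "comult_op m \<rho> \<sigma> E0 x y = m (\<rho> E0 x) (\<sigma> Kinv y) + m x (\<sigma> E0 y)"
| "comult_op m \<rho> \<sigma> F0 x y = m (\<rho> F0 x) y + m (\<rho> K x) (\<sigma> F0 y)"
| "comult_op m \<rho> \<sigma> E1 x y = m (\<rho> E1 x) (\<sigma> K y) + m x (\<sigma> E1 y)"
| "comult_op m \<rho> \<sigma> F1 x y = m (\<rho> F1 x) y + m (\<rho> Kinv x) (\<sigma> F1 y)"

lemma bilinear_op_comult_op:
  assumes m: "bilinear_op m" and \<rho>: "\<And>g. linear_op (\<rho> g)" and \<sigma>: "\<And>g. linear_op (\<sigma> g)"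
  shows "bilinear_op (comult_op m \<rho> \<sigma> g)"
proof -
  note c = bilinear_op_compose[OF m]
  show ?thesis
    by (cases g) (auto simp: comult_op.simps[abs_def]
        intro!: bilinear_op_plus c[OF \<rho> \<sigma>] c[OF \<rho> linear_op_id(2)] c[OF linear_op_id(2) \<sigma>])
qed

text \<open>In each Serre relation the group-like factors attached to the two generators are mutually
  inverse and scale them by opposite powers of \<open>q\<^sup>2\<close>, so all four instances are covered.\<close>

lemma serre_act_comult:
  assumes q: "q \<noteq> 0" and m: "bilinear_op m" and lin: "linear_op f" "linear_op g"
    "linear_op a" "linear_op b" "linear_op A" "linear_op B" "linear_op k" "linear_op l"
    and X: "\<And>x. x \<in> X \<Longrightarrow> a x \<in> X" "\<And>x. x \<in> X \<Longrightarrow> b x \<in> X"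
    and Y: "\<And>y. y \<in> Y \<Longrightarrow> A y \<in> Y" "\<And>y. y \<in> Y \<Longrightarrow> B y \<in> Y" "\<And>y. y \<in> Y \<Longrightarrow> k y \<in> Y"
      "\<And>y. y \<in> Y \<Longrightarrow> l y \<in> Y"
    and f: "\<And>x y. x \<in> X \<Longrightarrow> y \<in> Y \<Longrightarrow> f (m x y) = m (a x) (k y) + m x (A y)"
    and g: "\<And>x y. x \<in> X \<Longrightarrow> y \<in> Y \<Longrightarrow> g (m x y) = m (b x) (l y) + m x (B y)"
    and kl: "\<And>y. y \<in> Y \<Longrightarrow> k (l y) = y" "\<And>y. y \<in> Y \<Longrightarrow> l (k y) = y"
    and comm: "\<And>y. y \<in> Y \<Longrightarrow> k (A y) = smul (q\<^sup>2) (A (k y))"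
      "\<And>y. y \<in> Y \<Longrightarrow> k (B y) = smul (inverse (q\<^sup>2)) (B (k y))"
      "\<And>y. y \<in> Y \<Longrightarrow> l (A y) = smul (inverse (q\<^sup>2)) (A (l y))"
      "\<And>y. y \<in> Y \<Longrightarrow> l (B y) = smul (q\<^sup>2) (B (l y))"
    and serre: "\<And>x. x \<in> X \<Longrightarrow> serre_act q a b x = 0" "\<And>y. y \<in> Y \<Longrightarrow> serre_act q A B y = 0"
    and xy: "x \<in> X" "y \<in> Y"
  shows "serre_act q f g (m x y) = 0"
proof -
  \<comment> \<open>With \<open>t\<close> and \<open>r\<close> for the powers of \<open>q\<close>,
    all coefficients are polynomials in two letters subject to \<open>t * r = 1\<close>.\<close>
  define t r where "t = q\<^sup>2" and "r = inverse t"
  have tr: "t * r = 1" using q by (simp add: t_def r_def)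
  have tr': "r * t = 1" "t * r = 1" "r * (t * z) = z" "t * (r * z) = z" for z
    using tr by (simp_all add: mult.commute flip: mult.assoc)
  note comm = comm[folded t_def, folded r_def] and serre = serre[unfolded serre_act_def, folded
      t_def, folded r_def]
  \<comment> \<open>Solved for the monomial with the cube in front, the Serre relations become
    rewrite rules. They remove the terms in which all four operators act on the same factor; the
    mixed terms cancel through the powers of \<open>q\<close> produced by moving \<open>k\<close>
    and \<open>l\<close>.\<close>
  have serre_a: "a (a (a (b x)))
      = smul (t + 1 + r) (a (a (b (a x)))) - smul (t + 1 + r) (a (b (a (a x)))) + b (a (a (a x)))"
    if "x \<in> X" for x
    using serre(1)[OF that] by (simp add: algebra_simps)
  have serre_A: "A (A (A (B y)))
      = smul (t + 1 + r) (A (A (B (A y)))) - smul (t + 1 + r) (A (B (A (A y)))) + B (A (A (A y)))"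
    if "y \<in> Y" for y
    using serre(2)[OF that] by (simp add: algebra_simps)
  show ?thesis
  proof (rule poly_mapping_eqI)
    fix i
    show "Poly_Mapping.lookup (serre_act q f g (m x y)) i = Poly_Mapping.lookup 0 i"
      unfolding serre_act_def t_def[symmetric] unfolding r_def[symmetric]
      by (simp add: xy X Y f g kl comm serre_a serre_A lin[THEN linear_opD(1)]
          lin[THEN linear_opD(2)] lin[THEN linear_opD(5)] bilinear_op_simps(1,2,5,6,7,10)[OF m]
          smul_add_right smul_diff_right lookup_add lookup_minus,
        simp add: algebra_simps tr')
  qed
qed

text \<open>Evaluating the conjugation relations at \<open>K v\<close> gives rules that push
  \<open>K\<close> inwards. Those for \<open>Kinv\<close> result from the rules for \<open>K\<close>
  at \<open>Kinv v\<close> by applying \<open>Kinv\<close>.\<close>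

lemma U_action_K_commute:
  assumes q: "q \<noteq> 0" and \<rho>: "U_action q B \<rho>" and v: "v \<in> supp_space B"
  shows "\<rho> K (\<rho> Kinv v) = v" "\<rho> Kinv (\<rho> K v) = v"
    and "\<rho> K (\<rho> E1 v) = smul (q\<^sup>2) (\<rho> E1 (\<rho> K v))"
    and "\<rho> K (\<rho> F1 v) = smul (inverse (q\<^sup>2)) (\<rho> F1 (\<rho> K v))"
    and "\<rho> K (\<rho> E0 v) = smul (inverse (q\<^sup>2)) (\<rho> E0 (\<rho> K v))"
    and "\<rho> K (\<rho> F0 v) = smul (q\<^sup>2) (\<rho> F0 (\<rho> K v))"
    and "\<rho> Kinv (\<rho> E1 v) = smul (inverse (q\<^sup>2)) (\<rho> E1 (\<rho> Kinv v))"
    and "\<rho> Kinv (\<rho> F1 v) = smul (q\<^sup>2) (\<rho> F1 (\<rho> Kinv v))"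
    and "\<rho> Kinv (\<rho> E0 v) = smul (q\<^sup>2) (\<rho> E0 (\<rho> Kinv v))"
    and "\<rho> Kinv (\<rho> F0 v) = smul (inverse (q\<^sup>2)) (\<rho> F0 (\<rho> Kinv v))"
proof -
  note lin = U_actionD(1)[OF \<rho>] and closed = U_actionD(2)[OF \<rho>]
  have rel: "\<forall>r\<in>U_relations q. free_eval \<rho> r v = 0" if "v \<in> supp_space B" for v
    using U_actionD(3)[OF \<rho> that] by blast
  note rels = rel[unfolded free_eval_relations[OF lin]]
  have KK: "\<rho> K (\<rho> Kinv v) = v" "\<rho> Kinv (\<rho> K v) = v" if "v \<in> supp_space B" for v
    using rels[OF that] by auto
  then show "\<rho> K (\<rho> Kinv v) = v" "\<rho> Kinv (\<rho> K v) = v" using v by auto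
  have KE1: "\<rho> K (\<rho> E1 v) = smul (q\<^sup>2) (\<rho> E1 (\<rho> K v))"
    and KF1: "\<rho> K (\<rho> F1 v) = smul (inverse (q\<^sup>2)) (\<rho> F1 (\<rho> K v))"
    and KE0: "\<rho> K (\<rho> E0 v) = smul (inverse (q\<^sup>2)) (\<rho> E0 (\<rho> K v))"
    and KF0: "\<rho> K (\<rho> F0 v) = smul (q\<^sup>2) (\<rho> F0 (\<rho> K v))" if v: "v \<in> supp_space B" for v
    using rels[OF closed[OF v, of K]] KK(2)[OF v] by simp_all
  then show "\<rho> K (\<rho> E1 v) = smul (q\<^sup>2) (\<rho> E1 (\<rho> K v))"
    and "\<rho> K (\<rho> F1 v) = smul (inverse (q\<^sup>2)) (\<rho> F1 (\<rho> K v))"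
    and "\<rho> K (\<rho> E0 v) = smul (inverse (q\<^sup>2)) (\<rho> E0 (\<rho> K v))"
    and "\<rho> K (\<rho> F0 v) = smul (q\<^sup>2) (\<rho> F0 (\<rho> K v))"
    using v by simp_all
  have *: "\<rho> Kinv (\<rho> g v) = smul (inverse c) (\<rho> g (\<rho> Kinv v))"
    if c: "c \<noteq> 0" and "\<rho> K (\<rho> g (\<rho> Kinv v)) = smul c (\<rho> g (\<rho> K (\<rho> Kinv v)))" for g c
  proof -
    have "\<rho> g v = smul (inverse c) (\<rho> K (\<rho> g (\<rho> Kinv v)))"
      using that KK(1)[OF v] by simp
    then show ?thesis
      using KK(2)[OF closed[OF closed[OF v]]] by (simp add: linear_opD[OF lin])
  qed
  note v' = closed[OF v, of Kinv]
  show "\<rho> Kinv (\<rho> E1 v) = smul (inverse (q\<^sup>2)) (\<rho> E1 (\<rho> Kinv v))"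
    and "\<rho> Kinv (\<rho> F1 v) = smul (q\<^sup>2) (\<rho> F1 (\<rho> Kinv v))"
    and "\<rho> Kinv (\<rho> E0 v) = smul (q\<^sup>2) (\<rho> E0 (\<rho> Kinv v))"
    and "\<rho> Kinv (\<rho> F0 v) = smul (inverse (q\<^sup>2)) (\<rho> F0 (\<rho> Kinv v))"
    using *[OF _ KE1[OF v']] *[OF _ KF1[OF v']] *[OF _ KE0[OF v']] *[OF _ KF0[OF v']] q by simp_all
qed

text \<open>The compatibility of the coproduct with the relations, tested on pure tensors, where the
  operators are known explicitly.\<close>

lemma free_eval_relations_comult:
  assumes q: "q \<noteq> 0" and \<rho>: "U_action q A \<rho>" and \<sigma>: "U_action q B \<sigma>"
    and m: "bilinear_op m" and lin: "\<And>g. linear_op (\<tau> g)"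
    and \<tau>: "\<And>g x y. x \<in> supp_space A \<Longrightarrow> y \<in> supp_space B \<Longrightarrow> \<tau> g (m x y) = comult_op m \<rho> \<sigma> g x y"
    and x: "x \<in> supp_space A" and y: "y \<in> supp_space B" and r: "r \<in> U_relations q"
  shows "free_eval \<tau> r (m x y) = 0"
proof -
  note \<rho>lin = U_actionD(1)[OF \<rho>] and \<rho>cl = U_actionD(2)[OF \<rho>]
  note \<sigma>lin = U_actionD(1)[OF \<sigma>] and \<sigma>cl = U_actionD(2)[OF \<sigma>]
  note \<rho>K = U_action_K_commute[OF q \<rho>] and \<sigma>K = U_action_K_commute[OF q \<sigma>]
  have \<rho>rel: "\<forall>r\<in>U_relations q. free_eval \<rho> r x = 0" if "x \<in> supp_space A" for x
    using U_actionD(3)[OF \<rho> that] by blast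
  have \<sigma>rel: "\<forall>r\<in>U_relations q. free_eval \<sigma> r x = 0" if "x \<in> supp_space B" for x
    using U_actionD(3)[OF \<sigma> that] by blast
  note \<rho>rels = \<rho>rel[unfolded free_eval_relations[OF \<rho>lin]]
  note \<sigma>rels = \<sigma>rel[unfolded free_eval_relations[OF \<sigma>lin]]
  \<comment> \<open>\<open>serre_act_comult\<close> expects the group-like factor in the second
    argument. The coproducts of \<open>F0\<close> and \<open>F1\<close> carry it in the first, so
    the pairing is flipped for them.\<close>
  note flip = bilinear_op_flip[OF m]
  have sE0: "serre_act q (\<tau> E0) (\<tau> E1) (m x y) = 0"
    by (rule serre_act_comult[OF q m, where X = "supp_space A" and Y = "supp_space B"
          and a = "\<rho> E0" and b = "\<rho> E1" and A = "\<sigma> E0" and B = "\<sigma> E1"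
          and k = "\<sigma> Kinv" and l = "\<sigma> K"])
      (use x y \<rho>rels \<sigma>rels in \<open>auto simp: \<tau> lin \<rho>lin \<sigma>lin \<rho>cl \<sigma>cl \<sigma>K\<close>)
  have sE1: "serre_act q (\<tau> E1) (\<tau> E0) (m x y) = 0"
    by (rule serre_act_comult[OF q m, where X = "supp_space A" and Y = "supp_space B"
          and a = "\<rho> E1" and b = "\<rho> E0" and A = "\<sigma> E1" and B = "\<sigma> E0"
          and k = "\<sigma> K" and l = "\<sigma> Kinv"])
      (use x y \<rho>rels \<sigma>rels in \<open>auto simp: \<tau> lin \<rho>lin \<sigma>lin \<rho>cl \<sigma>cl \<sigma>K\<close>)
  have sF0: "serre_act q (\<tau> F0) (\<tau> F1) (m x y) = 0"
    by (rule serre_act_comult[OF q flip, where X = "supp_space B" and Y = "supp_space A"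
          and a = "\<sigma> F0" and b = "\<sigma> F1" and A = "\<rho> F0" and B = "\<rho> F1"
          and k = "\<rho> K" and l = "\<rho> Kinv"])
      (use x y \<rho>rels \<sigma>rels in \<open>auto simp: \<tau> lin \<rho>lin \<sigma>lin \<rho>cl \<sigma>cl \<rho>K\<close>)
  have sF1: "serre_act q (\<tau> F1) (\<tau> F0) (m x y) = 0"
    by (rule serre_act_comult[OF q flip, where X = "supp_space B" and Y = "supp_space A"
          and a = "\<sigma> F1" and b = "\<sigma> F0" and A = "\<rho> F1" and B = "\<rho> F0"
          and k = "\<rho> Kinv" and l = "\<rho> K"])
      (use x y \<rho>rels \<sigma>rels in \<open>auto simp: \<tau> lin \<rho>lin \<sigma>lin \<rho>cl \<sigma>cl \<rho>K\<close>)
  \<comment> \<open>Dropping six conjuncts leaves the commutator and Serre rules; the relations for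
    \<open>K\<close> are used in the commutation form of \<open>\<rho>K\<close> and
    \<open>\<sigma>K\<close> instead.\<close>
  note \<rho>comm = \<rho>rels[THEN conjunct2, THEN conjunct2, THEN conjunct2, THEN conjunct2, THEN
      conjunct2, THEN conjunct2]
  note \<sigma>comm = \<sigma>rels[THEN conjunct2, THEN conjunct2, THEN conjunct2, THEN conjunct2, THEN
      conjunct2, THEN conjunct2]
  have "\<forall>r\<in>U_relations q. free_eval \<tau> r (m x y) = 0"
    unfolding free_eval_relations[OF lin]
    by (intro conjI sE0 sE1 sF0 sF1)
      (simp_all add: q x y \<tau> \<rho>cl \<sigma>cl \<rho>K \<sigma>K \<rho>comm \<sigma>comm linear_opD[OF lin] linear_opD[OF \<rho>lin]
          linear_opD[OF \<sigma>lin]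
        bilinear_op_simps[OF m] smul_diff_right smul_add_right)
  then show ?thesis using r by blast
qed

section \<open>The action of the tensor square of the free algebra\<close>

definition free_eval2 where
  "free_eval2 \<rho> \<sigma> z v = lin_ext (\<lambda>(m, n). op_tensor (foldr \<rho> m) (foldr \<sigma> n) v) z"

lemma linear_op_free_eval2_left: "linear_op (\<lambda>z. free_eval2 \<rho> \<sigma> z v)"
  by (simp add: free_eval2_def)

lemma linear_op_free_eval2: "linear_op (free_eval2 \<rho> \<sigma> z)"
  unfolding free_eval2_def
  by (rule linear_op_lin_ext_pointwise) (auto split: prod.split)

lemma free_eval2_vec [simp]:
  "free_eval2 \<rho> \<sigma> (vec (m, n)) v = op_tensor (foldr \<rho> m) (foldr \<sigma> n) v"
  by (simp add: free_eval2_def)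

lemma op_tensor_compose:
  assumes "linear_op S" and "linear_op T"
  shows "op_tensor (\<lambda>x. S (S' x)) (\<lambda>x. T (T' x)) v = op_tensor S T (op_tensor S' T' v)"
  by (rule linear_op_eqI[where g = "\<lambda>v. op_tensor S T (op_tensor S' T' v)"])
    (auto simp: op_tensor_vtensor[OF assms] op_tensor_def[of S' T']
      op_tensor_def[of "\<lambda>x. S (S' x)"] linear_op_compose[OF linear_op_op_tensor linear_op_lin_ext])

lemma op_tensor_id: "op_tensor id id v = v"
  by (rule linear_op_eqI[where g = "\<lambda>v. v"]) (auto simp: linear_op_id op_tensor_def)

lemma free_eval2_mult:
  assumes "\<And>g. linear_op (\<rho> g)" and "\<And>g. linear_op (\<sigma> g)"
  shows "free_eval2 \<rho> \<sigma> (z * z') v = free_eval2 \<rho> \<sigma> z (free_eval2 \<rho> \<sigma> z' v)"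
proof (rule bilinear_op_eq_on[where A = UNIV and B = UNIV and m = "\<lambda>z z'. free_eval2 \<rho> \<sigma> (z * z') v"
      and m' = "\<lambda>z z'. free_eval2 \<rho> \<sigma> z (free_eval2 \<rho> \<sigma> z' v)"])
  show "bilinear_op (\<lambda>z z'. free_eval2 \<rho> \<sigma> (z * z') v)"
    by (rule linear_op_bilinear_op[OF linear_op_free_eval2_left bilinear_op_times])
  show "bilinear_op (\<lambda>z z'. free_eval2 \<rho> \<sigma> z (free_eval2 \<rho> \<sigma> z' v))"
    unfolding bilinear_op_def
    by (intro conjI allI linear_op_free_eval2_left
        linear_op_compose[OF linear_op_free_eval2 linear_op_free_eval2_left])
  fix i j
  show "free_eval2 \<rho> \<sigma> (vec i * vec j) v = free_eval2 \<rho> \<sigma> (vec i) (free_eval2 \<rho> \<sigma> (vec j) v)"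
    using op_tensor_compose[of "foldr \<rho> (fst i)" "foldr \<sigma> (snd i)" "foldr \<rho> (fst j)" "foldr \<sigma>
        (snd j)" v]
      linear_op_foldr[of \<rho>, OF assms(1)] linear_op_foldr[of \<sigma>, OF assms(2)]
    by (cases i; cases j) (simp add: times_vec plus_list_def foldr_append[abs_def] comp_def)
qed simp_all

lemma free_eval2_coproduct_gen:
  assumes "\<And>g. linear_op (\<rho> g)" and "\<And>g. linear_op (\<sigma> g)"
  shows "free_eval2 \<rho> \<sigma> (coproduct_gen g) (vtensor x y) = comult_op vtensor \<rho> \<sigma> g x y"
  by (cases g) (simp_all add: linear_opD[OF linear_op_free_eval2_left] comp_def
      op_tensor_vtensor assms linear_op_id id_def)

text \<open>The coproduct is multiplicative by construction, so acting through it is again an action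
  of the free algebra by six operators. This brings tensor products under the descent criterion
  \<open>U_action\<close>.\<close>

lemma free_eval2_coproduct:
  assumes "\<And>g. linear_op (\<rho> g)" and "\<And>g. linear_op (\<sigma> g)"
  shows "free_eval2 \<rho> \<sigma> (coproduct x) v = free_eval (\<lambda>g. free_eval2 \<rho> \<sigma> (coproduct_gen g)) x v"
proof (rule linear_op_eqI[where f = "\<lambda>x. free_eval2 \<rho> \<sigma> (coproduct x) v"])
  fix m
  have "free_eval2 \<rho> \<sigma> (prod_list (map coproduct_gen m)) v
      = foldr (\<lambda>g. free_eval2 \<rho> \<sigma> (coproduct_gen g)) m v"
    by (induction m) (simp_all add: free_eval2_mult[OF assms] one_eq_vec zero_prod_def
        zero_list_def op_tensor_id)
  then show "free_eval2 \<rho> \<sigma> (coproduct (vec m)) v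
      = free_eval (\<lambda>g. free_eval2 \<rho> \<sigma> (coproduct_gen g)) (vec m) v"
    by (simp add: coproduct_def)
qed (simp_all add: linear_op_free_eval_left coproduct_def
    linear_op_compose[OF linear_op_free_eval2_left linear_op_lin_ext])

text \<open>\<open>op_tensor\<close> consults its operators only at basis vectors, and those
  occurring in \<open>v\<close> lie in the spaces where the coset actions agree with the
  operators.\<close>

lemma tensor_eval_eq:
  assumes M: "realizes q M \<rho>" and N: "realizes q N \<sigma>" and v: "v \<in> supp_space (ubasis M \<times> ubasis N)"
  shows "tensor_eval q M N z v = free_eval2 \<rho> \<sigma> z v"
proof -
  have "op_tensor (uact M (U_class q (vec m))) (uact N (U_class q (vec n))) v
      = op_tensor (foldr \<rho> m) (foldr \<sigma> n) v" for m n
    unfolding op_tensor_def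
    by (rule lin_ext_cong_keys) (use M N v in \<open>auto simp: realizes_def supp_space_def\<close>)
  then show ?thesis by (simp add: tensor_eval_def free_eval2_def)
qed

text \<open>By linearity the relations need checking only at basis vectors; these are pure tensors,
  to which the coproduct formulas apply.\<close>

lemma realizes_tensor_module:
  assumes q: "q \<noteq> 0" and M: "realizes q M \<rho>" and N: "realizes q N \<sigma>"
  shows "realizes q (tensor_module q M N) (\<lambda>g. free_eval2 \<rho> \<sigma> (coproduct_gen g))"
proof -
  let ?A = "ubasis M" and ?B = "ubasis N" and ?\<tau> = "\<lambda>g. free_eval2 \<rho> \<sigma> (coproduct_gen g)"
  have \<rho>: "U_action q ?A \<rho>" and \<sigma>: "U_action q ?B \<sigma>"
    using M N by (auto simp: realizes_def)
  note \<rho>D = U_actionD[OF \<rho>] and \<sigma>D = U_actionD[OF \<sigma>]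
  have lin: "linear_op (?\<tau> g)" for g
    by (rule linear_op_free_eval2)
  have gen: "?\<tau> g (vtensor x y) = comult_op vtensor \<rho> \<sigma> g x y" for g x y
    by (intro free_eval2_coproduct_gen \<rho>D(1) \<sigma>D(1))
  have "U_action q (?A \<times> ?B) ?\<tau>"
    unfolding U_action_def
  proof (intro conjI allI ballI)
    show "linear_op (?\<tau> g)" for g
      by (rule lin)
  next
    fix g v assume v: "v \<in> supp_space (?A \<times> ?B)"
    show "?\<tau> g v \<in> supp_space (?A \<times> ?B)"
    proof (rule linear_op_supp_space[OF lin _ v])
      fix i assume i: "i \<in> ?A \<times> ?B"
      have "comult_op vtensor \<rho> \<sigma> g (vec (fst i)) (vec (snd i)) \<in> supp_space (?A \<times> ?B)"
        using i by (cases g) (auto intro!: supp_space_closed(2) vtensor_supp_space \<rho>D(2) \<sigma>D(2))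
      then show "?\<tau> g (vec i) \<in> supp_space (?A \<times> ?B)"
        using gen[of g "vec (fst i)" "vec (snd i)"] by simp
    qed
  next
    fix v r assume v: "v \<in> supp_space (?A \<times> ?B)" and r: "r \<in> U_relations q"
    show "free_eval ?\<tau> r v = 0"
    proof (rule linear_op_eq_on[where B = "?A \<times> ?B" and f = "free_eval ?\<tau> r" and g = "\<lambda>_. 0"])
      fix i assume i: "i \<in> ?A \<times> ?B"
      show "free_eval ?\<tau> r (vec i) = 0"
        using free_eval_relations_comult[OF q \<rho> \<sigma> bilinear_op_vtensor lin gen, of "vec (fst i)"
            "vec (snd i)" r]
          i r by auto
    qed (use v in \<open>auto simp: supp_space_def linear_op_zero intro!: linear_op_free_eval lin\<close>)
  qed
  then show ?thesis
    using the_elem_U_class[of q "?A \<times> ?B" ?\<tau>]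
    by (auto simp: realizes_def tensor_module_def tensor_eval_eq[OF M N] free_eval2_coproduct[OF
        \<rho>D(1) \<sigma>D(1)])
qed


section \<open>Words\<close>

definition counit :: "ugen \<Rightarrow> complex" where
  "counit g = (if g = K \<or> g = Kinv then 1 else 0)"

lemma trivial_op_eq: "trivial_op g = smul (counit g)"
  by (cases g) (auto simp: counit_def)

lemma realizes_trivial_module: "realizes q trivial_module trivial_op"
proof -
  have lin: "linear_op (trivial_op g)" for g
    by (simp add: trivial_op_eq linear_op_smul)
  have "\<forall>r\<in>U_relations q. free_eval trivial_op r v = 0" for v
    unfolding free_eval_relations[OF lin] by (simp add: serre_act_def)
  then show ?thesis
    unfolding trivial_module_def by (intro realizes_gen_module) (simp add: U_action_def lin)
qed

lemma linear_op_evaluation_op: "linear_op (evaluation_op q a g)"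
  by (cases g) (simp_all add: linear_op_compose[OF linear_op_smul linear_op_lin_ext])

lemma realizes_evaluation_module:
  assumes q: "q \<noteq> 0" and q2: "q\<^sup>2 \<noteq> 1"
  shows "realizes q (evaluation_module q a) (evaluation_op q a)"
proof -
  let ?\<rho> = "evaluation_op q a"
  note lin = linear_op_evaluation_op
  \<comment> \<open>The assumption on \<open>q\<^sup>2\<close> enters through the denominator
    \<open>q - inverse q\<close>.\<close>
  have inv: "q * inverse q = 1" "q - inverse q \<noteq> 0"
    using q q2 by (auto simp: field_simps power2_eq_square)
  have pw: "q powi a * q powi (- a) = 1"
    using q by (simp flip: power_int_add)
  \<comment> \<open>On a basis vector the eigenvalues of \<open>K\<close> and \<open>Kinv\<close>
    differ by \<open>q - inverse q\<close> up to sign, so the Cartan term of the commutators is the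
    identity or its negative.\<close>
  have c: "smul (1 / (q - inverse q)) (smul q v - smul (inverse q) v) = v" for v :: "sign \<Rightarrow>\<^sub>0
      complex"
    using inv(2) by (simp flip: smul_diff_left)
  have c': "smul (1 / (q - inverse q)) (smul (inverse q) v - smul q v) = - v" for v :: "sign \<Rightarrow>\<^sub>0
      complex"
    using arg_cong[OF c[of v], of uminus] by (simp flip: smul_minus_right)
  have rel: "\<forall>r\<in>U_relations q. free_eval ?\<rho> r (vec s) = 0" for s
    unfolding free_eval_relations[OF lin]
    by (cases s) (simp_all add: serre_act_def lin_ext_simps raise_def lower_def q inv c c' pw
        mult_ac power2_eq_square)
  have "free_eval ?\<rho> r v = 0" if "r \<in> U_relations q" for r v
    by (rule linear_op_eqI[OF linear_op_free_eval[of ?\<rho> r, OF lin] linear_op_zero, of v])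
      (use rel that in blast)
  then show ?thesis
    unfolding evaluation_module_def by (intro realizes_gen_module) (simp add: U_action_def lin)
qed

text \<open>Sign lists form a free monoid, so the convolution product \<open>(*)\<close> concatenates them, and it
  serves as a strictly associative tensor product of word modules.\<close>

definition letters :: "(sign \<Rightarrow>\<^sub>0 complex) \<Rightarrow> (sign list \<Rightarrow>\<^sub>0 complex)" where
  "letters = lin_ext (\<lambda>s. vec [s])"

lemma letters_vec [simp]: "letters (vec s) = vec [s]"
  by (simp add: letters_def)

lemma linear_op_letters: "linear_op letters"
  by (simp add: letters_def)

abbreviation cons_tensor where "cons_tensor \<equiv> \<lambda>x y. letters x * y"
abbreviation snoc_tensor where "snoc_tensor \<equiv> \<lambda>x y. x * letters y"

lemma bilinear_op_cons_tensor: "bilinear_op cons_tensor"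
  by (rule bilinear_op_compose[OF bilinear_op_times linear_op_letters linear_op_id(2)])

lemma bilinear_op_snoc_tensor: "bilinear_op snoc_tensor"
  by (rule bilinear_op_compose[OF bilinear_op_times linear_op_id(2) linear_op_letters])

lemma vec_Nil: "vec [] = 1"
  by (simp add: one_eq_vec zero_list_def)

lemma vec_Cons: "vec (s # t) = vec [s] * vec t"
  by (simp add: times_vec plus_list_def)

text \<open>The action on a word as a recursion on sign lists, free of cosets and relabelling.
  Starting from the counit at the empty word makes a single letter no special case, unlike in
  \<open>word_module\<close>. The \<open>0\<close> at the empty list is a default outside the space
  of a nonempty word.\<close>

primrec word_op ::
  "complex \<Rightarrow> int list \<Rightarrow> ugen \<Rightarrow> (sign list \<Rightarrow>\<^sub>0 complex) \<Rightarrow> (sign list \<Rightarrow>\<^sub>0 complex)" where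
  "word_op q [] g = smul (counit g)"
| "word_op q (a # w) g = lin_ext (\<lambda>t. case t of [] \<Rightarrow> 0
     | s # t' \<Rightarrow> comult_op cons_tensor (evaluation_op q a) (word_op q w) g (vec s) (vec t'))"

lemma linear_op_word_op: "linear_op (word_op q w g)"
  by (cases w) (simp_all add: linear_op_smul)

lemma word_op_Cons:
  "word_op q (a # w) g (letters x * y)
    = comult_op cons_tensor (evaluation_op q a) (word_op q w) g x y"
proof (rule bilinear_op_eq_on[where A = UNIV and B = UNIV and m = "\<lambda>x y. word_op q (a # w) g
    (letters x * y)"])
  show "bilinear_op (\<lambda>x y. word_op q (a # w) g (letters x * y))"
    by (rule linear_op_bilinear_op[OF linear_op_word_op bilinear_op_cons_tensor])
  show "bilinear_op (comult_op cons_tensor (evaluation_op q a) (word_op q w) g)"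
    by (intro bilinear_op_comult_op bilinear_op_cons_tensor linear_op_evaluation_op
        linear_op_word_op)
qed (simp_all flip: vec_Cons)

declare word_op.simps(2) [simp del]

text \<open>The counit axiom on generators: on the right, group-like factors act by
  \<open>1\<close>, and summands with an \<open>e\<close> or \<open>f\<close> there vanish.\<close>

lemma comult_op_Nil_right:
  assumes "bilinear_op m" and "linear_op (\<rho> g)"
  shows "comult_op m \<rho> (word_op q []) g x y = m (\<rho> g x) y"
  by (cases g) (simp_all add: counit_def bilinear_op_simps[OF assms(1)])

lemma comult_op_Nil_left:
  assumes "bilinear_op m" and "linear_op (\<sigma> g)"
  shows "comult_op m (word_op q []) \<sigma> g x y = m x (\<sigma> g y)"
  by (cases g) (simp_all add: counit_def bilinear_op_simps[OF assms(1)])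

lemma ubasis_word_module: "ubasis (word_module q w) = {t. length t = length w}"
  by (induction q w rule: word_module.induct)
    (auto simp: relabel_def trivial_module_def evaluation_module_def gen_module_def
        tensor_module_def
      length_Suc_conv image_iff)

text \<open>Connects the nested, relabelled tensor products with the flat recursion on which all
  later computations run.\<close>

lemma realizes_word_module:
  assumes q: "q \<noteq> 0" and q2: "q\<^sup>2 \<noteq> 1"
  shows "realizes q (word_module q w) (word_op q w)"
proof (induction w rule: induct_list012)
  case 1
  show ?case
    unfolding word_module.simps
    by (rule realizes_relabel[OF realizes_trivial_module])
      (auto simp: linear_op_smul trivial_op_eq lin_ext_simps inj_on_def)
next
  case (2 a)
  have "word_op q [a] g (vec [s]) = letters (evaluation_op q a g (vec s))" for g s
    using word_op_Cons[of q a "[]" g "vec s" 1]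
    by (simp del: word_op.simps add: comult_op_Nil_right[OF bilinear_op_cons_tensor
        linear_op_evaluation_op])
  then show ?case
    unfolding word_module.simps
    by (intro realizes_relabel[OF realizes_evaluation_module[OF q q2]])
      (auto simp: linear_op_word_op letters_def inj_on_def)
next
  case (3 a b w)
  let ?M = "evaluation_module q a" and ?N = "word_module q (b # w)"
    and ?\<rho> = "evaluation_op q a" and ?\<sigma> = "word_op q (b # w)"
  let ?push = "lin_ext (\<lambda>i. vec (case i of (s, t) \<Rightarrow> s # t))"
  \<comment> \<open>Relabelling pairs as nonempty lists turns \<open>vtensor\<close> into
    concatenation, and thereby one instance of the coproduct formula into the other.\<close>
  have push: "?push (vtensor x y) = letters x * y" for x y
    by (rule bilinear_op_eq_on[where A = UNIV and B = UNIV and m' = cons_tensor])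
      (simp_all add: linear_op_bilinear_op[OF linear_op_lin_ext bilinear_op_vtensor]
        bilinear_op_cons_tensor flip: vec_Cons)
  have push_comult: "?push (comult_op vtensor ?\<rho> ?\<sigma> g x y) = comult_op cons_tensor ?\<rho> ?\<sigma> g x y"
      for g x y
    by (cases g) (simp_all only: comult_op.simps lin_ext_simps push)
  show ?case
    unfolding word_module.simps
  proof (rule realizes_relabel[OF realizes_tensor_module[OF q realizes_evaluation_module[OF q q2]
      3(2)]])
    fix g and i :: "sign \<times> sign list"
    obtain s t where i: "i = (s, t)" by (cases i)
    have "?push (free_eval2 ?\<rho> ?\<sigma> (coproduct_gen g) (vtensor (vec s) (vec t)))
        = word_op q (a # b # w) g (letters (vec s) * vec t)"
      unfolding word_op_Cons[of q a "b # w"]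
        free_eval2_coproduct_gen[of ?\<rho> ?\<sigma>, OF linear_op_evaluation_op linear_op_word_op]
            push_comult ..
    then show "word_op q (a # b # w) g (vec (case i of (s, t) \<Rightarrow> s # t))
        = ?push (free_eval2 ?\<rho> ?\<sigma> (coproduct_gen g) (vec i))"
      by (simp add: i flip: vec_Cons)
  next
    show "inj_on (\<lambda>(s, t). s # t) (ubasis (tensor_module q ?M ?N))"
      by (rule inj_onI) auto
  qed (rule linear_op_word_op)
qed

text \<open>Coassociativity: a word may be split before its last letter as well as after its first.
  The restriction on \<open>x\<close> makes list and word split at the same place; otherwise signs
  would meet the wrong letters.\<close>

lemma word_op_snoc:
  assumes "x \<in> supp_space {t. length t = length w}"
  shows "word_op q (w @ [b]) g (x * letters y)
    = comult_op snoc_tensor (word_op q w) (evaluation_op q b) g x y"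
  using assms
proof (induction w arbitrary: g x y)
  case Nil
  have base: "word_op q [b] g (vec [] * letters y)
      = comult_op snoc_tensor (word_op q []) (evaluation_op q b) g (vec []) y"
  proof -
    have "word_op q [b] g (letters y) = letters (evaluation_op q b g y)"
      using word_op_Cons[of q b "[]" g y 1]
      by (simp del: word_op.simps add: comult_op_Nil_right[OF bilinear_op_cons_tensor
          linear_op_evaluation_op])
    then show ?thesis
      by (simp del: word_op.simps add: comult_op_Nil_left[OF bilinear_op_snoc_tensor
          linear_op_evaluation_op] vec_Nil)
  qed
  show ?case
  proof (rule linear_op_eq_on[where f = "\<lambda>x. word_op q ([] @ [b]) g (x * letters y)"
        and g = "\<lambda>x. comult_op snoc_tensor (word_op q []) (evaluation_op q b) g x y" and B =
            "{[]}", rotated 2])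
    show "linear_op (\<lambda>x. word_op q ([] @ [b]) g (x * letters y))"
      by (rule bilinear_opD(1)[OF linear_op_bilinear_op[OF linear_op_word_op
          bilinear_op_snoc_tensor]])
    show "linear_op (\<lambda>x. comult_op snoc_tensor (word_op q []) (evaluation_op q b) g x y)"
      by (rule bilinear_opD(1)[OF bilinear_op_comult_op[OF bilinear_op_snoc_tensor linear_op_word_op
            linear_op_evaluation_op]])
  qed (use Nil base in \<open>auto simp: supp_space_def\<close>)
next
  case (Cons a w)
  show ?case
  proof (rule linear_op_eq_on[where f = "\<lambda>x. word_op q ((a # w) @ [b]) g (x * letters y)"
        and g = "\<lambda>x. comult_op snoc_tensor (word_op q (a # w)) (evaluation_op q b) g x y"
        and B = "{t. length t = length (a # w)}"])
    fix t :: "sign list" assume "t \<in> {t. length t = length (a # w)}"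
    then obtain s t' where t: "t = s # t'" and t': "length t' = length w"
      by (auto simp: length_Suc_conv)
    have IH: "word_op q (w @ [b]) g (vec t' * letters y)
        = comult_op snoc_tensor (word_op q w) (evaluation_op q b) g (vec t') y" for g y
      by (rule Cons.IH) (simp add: t')
    have split: "vec t = letters (vec s) * vec t'"
      by (simp add: t flip: vec_Cons)
    have "word_op q (a # (w @ [b])) g (letters (vec s) * (vec t' * letters y))
        = comult_op snoc_tensor (word_op q (a # w)) (evaluation_op q b) g (letters (vec s) * vec
            t') y"
      \<comment> \<open>Both sides expand to the threefold coproduct on first letter, middle word
        and last letter; associativity of concatenation identifies the terms.\<close>
      unfolding word_op_Cons
      by (cases g) (simp_all only: comult_op.simps word_op_Cons IH, simp_all add: algebra_simps)
    then show "word_op q ((a # w) @ [b]) g (vec t * letters y)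
        = comult_op snoc_tensor (word_op q (a # w)) (evaluation_op q b) g (vec t) y"
      by (simp add: split mult.assoc)
  next
    show "linear_op (\<lambda>x. word_op q ((a # w) @ [b]) g (x * letters y))"
      by (rule bilinear_opD(1)[OF linear_op_bilinear_op[OF linear_op_word_op
          bilinear_op_snoc_tensor]])
    show "linear_op (\<lambda>x. comult_op snoc_tensor (word_op q (a # w)) (evaluation_op q b) g x y)"
      by (rule bilinear_opD(1)[OF bilinear_op_comult_op[OF bilinear_op_snoc_tensor linear_op_word_op
            linear_op_evaluation_op]])
  qed (use Cons.prems in \<open>auto simp: supp_space_def\<close>)
qed


section \<open>The reversal map\<close>

fun gen_flip :: "ugen \<Rightarrow> ugen" where
  "gen_flip E0 = F1" | "gen_flip F1 = E0" | "gen_flip E1 = F0" | "gen_flip F0 = E1"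
| "gen_flip K = K" | "gen_flip Kinv = Kinv"

text \<open>Under \<open>gen_flip\<close>, \<open>e\<^sub>1\<close> acts on the letter \<open>a\<close> as \<open>q\<^bsup>-a\<^esup> e\<^sub>1\<close>; rescaling \<open>v\<^sub>-\<close> by
  \<open>q\<^bsup>-a\<^esup>\<close> turns the twisted module into the letter \<open>-a\<close>.\<close>

definition flip_coeff :: "complex \<Rightarrow> int \<Rightarrow> sign \<Rightarrow> complex" where
  "flip_coeff q a s = (case s of Plus \<Rightarrow> 1 | Minus \<Rightarrow> q powi (- a))"

definition letter_flip :: "complex \<Rightarrow> int \<Rightarrow> (sign \<Rightarrow>\<^sub>0 complex) \<Rightarrow> (sign \<Rightarrow>\<^sub>0 complex)" where
  "letter_flip q a = lin_ext (\<lambda>s. smul (flip_coeff q a s) (vec s))"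

definition word_flip_coeff :: "complex \<Rightarrow> int list \<Rightarrow> sign list \<Rightarrow> complex" where
  "word_flip_coeff q w t = (\<Prod>(a, s)\<leftarrow>zip w t. flip_coeff q a s)"

definition word_flip :: "complex \<Rightarrow> int list \<Rightarrow> (sign list \<Rightarrow>\<^sub>0 complex) \<Rightarrow> (sign list \<Rightarrow>\<^sub>0 complex)"
    where
  "word_flip q w = lin_ext (\<lambda>t. smul (word_flip_coeff q w t) (vec (rev t)))"

lemma linear_op_letter_flip: "linear_op (letter_flip q a)"
  by (simp add: letter_flip_def)

lemma linear_op_word_flip: "linear_op (word_flip q w)"
  by (simp add: word_flip_def)

text \<open>On the two basis vectors, the powers of \<open>q\<close> carried by \<open>E0\<close>
  and \<open>F0\<close> are matched by the rescaling of \<open>vec Minus\<close>.\<close>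

lemma letter_flip_evaluation_op:
  assumes "q \<noteq> 0"
  shows "letter_flip q a (evaluation_op q a g x)
    = evaluation_op q (- a) (gen_flip g) (letter_flip q a x)"
proof (rule linear_op_eqI[where f = "\<lambda>x. letter_flip q a (evaluation_op q a g x)"
      and g = "\<lambda>x. evaluation_op q (- a) (gen_flip g) (letter_flip q a x)"])
  have pw: "q powi a * q powi (- a) = 1" "q powi (- a) * q powi a = 1"
    using assms by (simp_all flip: power_int_add)
  show "letter_flip q a (evaluation_op q a g (vec s))
      = evaluation_op q (- a) (gen_flip g) (letter_flip q a (vec s))" for s
    by (cases g; cases s)
      (simp_all add: letter_flip_def flip_coeff_def raise_def lower_def lin_ext_simps pw
          mult.commute)
qed (rule linear_op_compose[OF linear_op_letter_flip linear_op_evaluation_op]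
    linear_op_compose[OF linear_op_evaluation_op linear_op_letter_flip])+

text \<open>Reversal is anti-multiplicative, so a recursion from the front of the source meets a
  recursion from the back of the target.\<close>

lemma word_flip_Cons:
  "word_flip q (a # w) (letters x * y) = word_flip q w y * letters (letter_flip q a x)"
proof (rule bilinear_op_eq_on[where A = UNIV and B = UNIV
      and m = "\<lambda>x y. word_flip q (a # w) (letters x * y)"
      and m' = "\<lambda>x y. word_flip q w y * letters (letter_flip q a x)"])
  show "bilinear_op (\<lambda>x y. word_flip q (a # w) (letters x * y))"
    by (rule linear_op_bilinear_op[OF linear_op_word_flip bilinear_op_cons_tensor])
  show "bilinear_op (\<lambda>x y. word_flip q w y * letters (letter_flip q a x))"
    by (rule bilinear_op_flip[OF bilinear_op_compose[OF bilinear_op_snoc_tensor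
          linear_op_word_flip linear_op_letter_flip]])
  fix s t
  show "word_flip q (a # w) (letters (vec s) * vec t)
      = word_flip q w (vec t) * letters (letter_flip q a (vec s))"
    by (simp add: word_flip_def letter_flip_def word_flip_coeff_def bilinear_op_simps[OF
        bilinear_op_times]
        linear_opD[OF linear_op_letters] times_vec plus_list_def mult.commute)
qed simp_all

lemma length_\<omega> [simp]: "length (\<omega> w) = length w"
  by (simp add: \<omega>_def)

lemma word_flip_supp_space:
  "x \<in> supp_space {t. length t = n} \<Longrightarrow> word_flip q w x \<in> supp_space {t. length t = n}"
  by (rule linear_op_supp_space[OF linear_op_word_flip]) (auto simp: word_flip_def)

lemma word_flip_word_op:
  assumes q: "q \<noteq> 0" and "x \<in> supp_space {t. length t = length w}"
  shows "word_flip q w (word_op q w g x) = word_op q (\<omega> w) (gen_flip g) (word_flip q w x)"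
  using assms(2)
proof (induction w arbitrary: g x)
  case Nil
  have "counit (gen_flip g) = counit g"
    by (cases g) (simp_all add: counit_def)
  then show ?case
    by (simp add: \<omega>_def linear_opD[OF linear_op_word_flip])
next
  case (Cons a w)
  show ?case
  proof (rule linear_op_eq_on[where f = "\<lambda>x. word_flip q (a # w) (word_op q (a # w) g x)"
        and g = "\<lambda>x. word_op q (\<omega> (a # w)) (gen_flip g) (word_flip q (a # w) x)"
        and B = "{t. length t = length (a # w)}"])
    fix t :: "sign list" assume "t \<in> {t. length t = length (a # w)}"
    then obtain s t' where t: "t = s # t'" and t': "length t' = length w"
      by (auto simp: length_Suc_conv)
    have IH: "word_flip q w (word_op q w g (vec t')) = word_op q (\<omega> w) (gen_flip g) (word_flip q
        w (vec t'))" for g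
      by (rule Cons.IH) (simp add: t')
    have split: "vec t = letters (vec s) * vec t'"
      by (simp add: t flip: vec_Cons)
    have supp: "word_flip q w (vec t') \<in> supp_space {t. length t = length (\<omega> w)}"
      using t' by (simp add: word_flip_supp_space)
    have \<omega>: "\<omega> (a # w) = \<omega> w @ [- a]"
      by (simp add: \<omega>_def)
    show "word_flip q (a # w) (word_op q (a # w) g (vec t))
        = word_op q (\<omega> (a # w)) (gen_flip g) (word_flip q (a # w) (vec t))"
      \<comment> \<open>For an \<open>e\<close> or \<open>f\<close>, the two coproduct summands at
        the front of \<open>a # w\<close> match those of the flipped generator at the end of
        \<open>\<omega> w @ [- a]\<close> in the opposite order, hence
        \<open>add.commute\<close>.\<close>
      unfolding split word_op_Cons word_flip_Cons \<omega> word_op_snoc[OF supp]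
      by (cases g) (simp_all del: letters_vec evaluation_op.simps
          add: linear_opD[OF linear_op_word_flip] word_flip_Cons IH
          letter_flip_evaluation_op[OF q] add.commute)
  qed (use Cons.prems in \<open>auto simp: supp_space_def linear_op_compose[OF linear_op_word_flip
      linear_op_word_op]
      linear_op_compose[OF linear_op_word_op linear_op_word_flip]\<close>)
qed

text \<open>After reversal each sign meets its old letter negated, so the powers of \<open>q\<close>
  at every \<open>Minus\<close> are mutually inverse.\<close>

lemma word_flip_coeff_\<omega>:
  assumes "q \<noteq> 0" and "length t = length w"
  shows "word_flip_coeff q (\<omega> w) (rev t) * word_flip_coeff q w t = 1"
  using assms(2)
proof (induction t w rule: list_induct2)
  case (Cons s t a w)
  have "flip_coeff q (- a) s * flip_coeff q a s = 1"
    using assms(1) by (cases s) (simp_all add: flip_coeff_def flip: power_int_add)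
  then show ?case
    using Cons by (simp add: word_flip_coeff_def \<omega>_def mult_ac)
qed (simp add: word_flip_coeff_def \<omega>_def)

lemma word_flip_\<omega>:
  assumes "q \<noteq> 0" and "x \<in> supp_space {t. length t = length w}"
  shows "word_flip q (\<omega> w) (word_flip q w x) = x"
proof (rule linear_op_eq_on[where f = "\<lambda>x. word_flip q (\<omega> w) (word_flip q w x)" and g = "\<lambda>x. x"
      and B = "{t. length t = length w}"])
  fix t :: "sign list" assume "t \<in> {t. length t = length w}"
  then show "word_flip q (\<omega> w) (word_flip q w (vec t)) = vec t"
    using word_flip_coeff_\<omega>[OF assms(1), of t w]
    by (simp add: word_flip_def lin_ext_simps mult.commute)
qed (use assms in \<open>auto simp: supp_space_def linear_op_id linear_op_compose[OF
    linear_op_word_flip linear_op_word_flip]\<close>)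


section \<open>Invariants\<close>

text \<open>Being a homomorphism can be tested on generators: one direction evaluates at their
  classes, the other extends the intertwining relation to the whole free algebra and thus to all
  cosets.\<close>

lemma H_eq:
  assumes "q \<noteq> 0" and "q\<^sup>2 \<noteq> 1"
  shows "H q w = {f. linear_op f \<and> (\<forall>v. f v \<in> supp_space {t. length t = length w})
    \<and> (\<forall>g v. word_op q w g (f v) = smul (counit g) (f v))}"
proof -
  let ?N = "word_module q w"
  have N: "uact ?N (U_class q x) v = free_eval (word_op q w) x v"
    if "v \<in> supp_space {t. length t = length w}" for x v
    using realizes_word_module[OF assms] that by (simp add: realizes_def ubasis_word_module)
  have B: "uspace trivial_module = UNIV"
    by (simp add: uspace_eq trivial_module_def gen_module_def)
  then have T: "uact trivial_module (U_class q x) v = free_eval trivial_op x v" for x v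
    using realizes_trivial_module[of q] by (simp add: realizes_def uspace_eq)
  have "(\<forall>u\<in>carrier (U q). \<forall>v. f (uact trivial_module u v) = uact ?N u (f v))
      \<longleftrightarrow> (\<forall>g v. word_op q w g (f v) = smul (counit g) (f v))"
    if f: "linear_op f" "\<And>v. f v \<in> supp_space {t. length t = length w}" for f
  proof
    assume hom: "\<forall>u\<in>carrier (U q). \<forall>v. f (uact trivial_module u v) = uact ?N u (f v)"
    show "\<forall>g v. word_op q w g (f v) = smul (counit g) (f v)"
    proof (intro allI)
      fix g v
      show "word_op q w g (f v) = smul (counit g) (f v)"
        using hom[unfolded carrier_U, THEN bspec, OF rangeI, of "gen g"] f
        by (simp add: N T trivial_op_eq linear_opD)
    qed
  next
    assume "\<forall>g v. word_op q w g (f v) = smul (counit g) (f v)"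
    then have "f (free_eval trivial_op x v) = free_eval (word_op q w) x (f v)" for x v
      using f by (intro free_eval_intertwine[where B = UNIV]) (auto simp: trivial_op_eq linear_opD)
    then show "\<forall>u\<in>carrier (U q). \<forall>v. f (uact trivial_module u v) = uact ?N u (f v)"
      using f by (auto simp: carrier_U N T)
  qed
  then show ?thesis
    unfolding H_def Hom_U_def B by (auto simp: uspace_eq ubasis_word_module linear_op_def)
qed

lemma word_flip_H:
  assumes "q \<noteq> 0" and "q\<^sup>2 \<noteq> 1" and f: "f \<in> H q w"
  shows "(\<lambda>v. word_flip q w (f v)) \<in> H q (\<omega> w)"
proof -
  have lin: "linear_op f" and supp: "f v \<in> supp_space {t. length t = length w}"
    and inv: "word_op q w g (f v) = smul (counit g) (f v)" for g v
    using f by (auto simp: H_eq[OF assms(1,2)])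
  have "word_op q (\<omega> w) g (word_flip q w (f v)) = smul (counit g) (word_flip q w (f v))" for g v
  proof -
    \<comment> \<open>The intertwining relation is used at \<open>gen_flip g\<close>, so that the
      involution leaves \<open>g\<close> itself acting on the target.\<close>
    have "gen_flip (gen_flip g) = g" "counit (gen_flip g) = counit g"
      by (cases g; simp add: counit_def)+
    then show ?thesis
      using word_flip_word_op[OF assms(1) supp, of "gen_flip g" v] inv
      by (simp add: linear_opD[OF linear_op_word_flip])
  qed
  then show ?thesis
    using supp by (simp add: H_eq[OF assms(1,2)] word_flip_supp_space linear_op_compose[OF
        linear_op_word_flip lin])
qed

theorem corollary4p11:
  fixes q :: complex and w :: "int list"
  assumes "q \<noteq> 0" and "\<And>n::nat. n > 0 \<Longrightarrow> q ^ n \<noteq> 1"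
    and "\<forall>a\<in>set w. even a"
  shows "hom_spaces_isomorphic (H q w) (H q (\<omega> w))"
proof -
  \<comment> \<open>Exponent 2 is the one that makes \<open>q - inverse q\<close>
    invertible.\<close>
  have q2: "q\<^sup>2 \<noteq> 1" using assms(2)[of 2] by simp
  have \<omega>\<omega>: "\<omega> (\<omega> w) = w" by (simp add: \<omega>_def rev_map comp_def)
  note H = H_eq[OF assms(1) q2] and flip = word_flip_H[OF assms(1) q2]
  have "bij_betw (\<lambda>f v. word_flip q w (f v)) (H q w) (H q (\<omega> w))"
  proof (rule bij_betw_byWitness[where f' = "\<lambda>f v. word_flip q (\<omega> w) (f v)"])
    show "\<forall>f\<in>H q w. (\<lambda>v. word_flip q (\<omega> w) (word_flip q w (f v))) = f"
      by (auto simp: H word_flip_\<omega>[OF assms(1)])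
    show "\<forall>f\<in>H q (\<omega> w). (\<lambda>v. word_flip q w (word_flip q (\<omega> w) (f v))) = f"
      using word_flip_\<omega>[OF assms(1), where w = "\<omega> w"] by (auto simp: H \<omega>\<omega>)
  qed (use flip flip[where w = "\<omega> w"] in \<open>auto simp: \<omega>\<omega>\<close>)
  then show ?thesis
    unfolding hom_spaces_isomorphic_def
    by (intro exI[of _ "\<lambda>f v. word_flip q w (f v)"])
      (auto simp: hom_smul_def plus_fun_def linear_opD[OF linear_op_word_flip])
qed

end
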